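(* (1) There exists a bounded linear operator $A\neq 0$ on a complex Hilbert space, with $\sigma(A)=\{0\}$ and $\limsup_{t\to\infty} t\,\|Ae^{tA}\|\le \frac1e$. (2) There exists a bounded linear operator $T\neq I$ on a complex Hilbert space, with $\sigma(T)=\{1\}$ and $\limsup_{n\to\infty} n\,\|T^{n+1}-T^n\|\le \frac1e$.
   Context: All spaces are complex. $\sigma(\cdot)$ denotes the spectrum, $I$ is the identity operator, $\|\cdot\|$ is the operator norm, and $e$ is the base of the natural logarithm. *)

theory Defs
  imports Complex_Main "HOL-Library.Extended_Real"
begin

text \<open>
  Hilbert spaces are structures on an explicit carrier, so that one can quantify
  existentially over the space itself. Values of the operations, and of operators,
  outside the carrier are irrelevant.
\<close>

record 'a inner_space =
  hcarrier :: "'a set"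
  hzero :: "'a"
  hadd :: "'a \<Rightarrow> 'a \<Rightarrow> 'a"
  hscale :: "complex \<Rightarrow> 'a \<Rightarrow> 'a"
  hinner :: "'a \<Rightarrow> 'a \<Rightarrow> complex"

definition hdiff :: "('a, 'b) inner_space_scheme \<Rightarrow> 'a \<Rightarrow> 'a \<Rightarrow> 'a" where
  "hdiff H x y = hadd H x (hscale H (-1) y)"

definition hnorm :: "('a, 'b) inner_space_scheme \<Rightarrow> 'a \<Rightarrow> real" where
  "hnorm H x = sqrt (Re (hinner H x x))"

text \<open>The inner product is linear in the first argument.\<close>

locale complex_inner_product_space =
  fixes H :: "('a, 'b) inner_space_scheme"
  assumes zero_closed: "hzero H \<in> hcarrier H"
    and add_closed: "\<lbrakk>x \<in> hcarrier H; y \<in> hcarrier H\<rbrakk> \<Longrightarrow> hadd H x y \<in> hcarrier H"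
    and scale_closed: "x \<in> hcarrier H \<Longrightarrow> hscale H c x \<in> hcarrier H"
    and add_assoc: "\<lbrakk>x \<in> hcarrier H; y \<in> hcarrier H; z \<in> hcarrier H\<rbrakk>
      \<Longrightarrow> hadd H (hadd H x y) z = hadd H x (hadd H y z)"
    and add_commute: "\<lbrakk>x \<in> hcarrier H; y \<in> hcarrier H\<rbrakk> \<Longrightarrow> hadd H x y = hadd H y x"
    and add_zero: "x \<in> hcarrier H \<Longrightarrow> hadd H x (hzero H) = x"
    and add_inverse: "x \<in> hcarrier H \<Longrightarrow> hadd H x (hscale H (-1) x) = hzero H"
    and scale_add_right: "\<lbrakk>x \<in> hcarrier H; y \<in> hcarrier H\<rbrakk>
      \<Longrightarrow> hscale H c (hadd H x y) = hadd H (hscale H c x) (hscale H c y)"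
    and scale_add_left: "x \<in> hcarrier H
      \<Longrightarrow> hscale H (c + d) x = hadd H (hscale H c x) (hscale H d x)"
    and scale_scale: "x \<in> hcarrier H \<Longrightarrow> hscale H c (hscale H d x) = hscale H (c * d) x"
    and scale_one: "x \<in> hcarrier H \<Longrightarrow> hscale H 1 x = x"
    and inner_add_left: "\<lbrakk>x \<in> hcarrier H; y \<in> hcarrier H; z \<in> hcarrier H\<rbrakk>
      \<Longrightarrow> hinner H (hadd H x y) z = hinner H x z + hinner H y z"
    and inner_scale_left: "\<lbrakk>x \<in> hcarrier H; y \<in> hcarrier H\<rbrakk>
      \<Longrightarrow> hinner H (hscale H c x) y = c * hinner H x y"
    and inner_commute: "\<lbrakk>x \<in> hcarrier H; y \<in> hcarrier H\<rbrakk>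
      \<Longrightarrow> hinner H x y = cnj (hinner H y x)"
    and inner_pos: "\<lbrakk>x \<in> hcarrier H; x \<noteq> hzero H\<rbrakk> \<Longrightarrow> 0 < Re (hinner H x x)"

locale complex_hilbert_space = complex_inner_product_space +
  assumes complete: "\<And>X :: nat \<Rightarrow> 'a.
    \<lbrakk>\<And>n. X n \<in> hcarrier H;
     \<And>e. e > 0 \<Longrightarrow> \<exists>N. \<forall>m\<ge>N. \<forall>n\<ge>N. hnorm H (hdiff H (X m) (X n)) < e\<rbrakk>
    \<Longrightarrow> \<exists>x\<in>hcarrier H. (\<lambda>n. hnorm H (hdiff H (X n) x)) \<longlonglongrightarrow> 0"

definition bounded_operator ::
  "('a, 'b) inner_space_scheme \<Rightarrow> ('a \<Rightarrow> 'a) \<Rightarrow> bool" where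
  "bounded_operator H A \<longleftrightarrow>
    (\<forall>x\<in>hcarrier H. A x \<in> hcarrier H) \<and>
    (\<forall>x\<in>hcarrier H. \<forall>y\<in>hcarrier H. A (hadd H x y) = hadd H (A x) (A y)) \<and>
    (\<forall>c. \<forall>x\<in>hcarrier H. A (hscale H c x) = hscale H c (A x)) \<and>
    (\<exists>K. \<forall>x\<in>hcarrier H. hnorm H (A x) \<le> K * hnorm H x)"

definition operator_norm ::
  "('a, 'b) inner_space_scheme \<Rightarrow> ('a \<Rightarrow> 'a) \<Rightarrow> real" where
  "operator_norm H A = (SUP x\<in>{x \<in> hcarrier H. hnorm H x \<le> 1}. hnorm H (A x))"

definition operator_spectrum ::
  "('a, 'b) inner_space_scheme \<Rightarrow> ('a \<Rightarrow> 'a) \<Rightarrow> complex set" where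
  "operator_spectrum H A =
    {z. \<not> (\<exists>B. bounded_operator H B \<and>
          (\<forall>x\<in>hcarrier H.
             B (hdiff H (hscale H z x) (A x)) = x \<and>
             hdiff H (hscale H z (B x)) (A (B x)) = x))}"

text \<open>Partial sums of the exponential series: the sum of \<open>A\<^sup>k / k!\<close> over \<open>k < n\<close>.\<close>

primrec exp_partial_sum ::
  "('a, 'b) inner_space_scheme \<Rightarrow> ('a \<Rightarrow> 'a) \<Rightarrow> nat \<Rightarrow> 'a \<Rightarrow> 'a" where
  "exp_partial_sum H A 0 x = hzero H"
| "exp_partial_sum H A (Suc n) x =
    hadd H (exp_partial_sum H A n x) (hscale H (1 / fact n) ((A ^^ n) x))"

text \<open>
  The limit of the exponential series in operator norm. For a bounded operator on a
  Hilbert space it exists and is unique on the carrier.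
\<close>

definition operator_exp ::
  "('a, 'b) inner_space_scheme \<Rightarrow> ('a \<Rightarrow> 'a) \<Rightarrow> 'a \<Rightarrow> 'a" where
  "operator_exp H A =
    (SOME E. bounded_operator H E \<and>
      (\<lambda>n. operator_norm H (\<lambda>x. hdiff H (exp_partial_sum H A n x) (E x))) \<longlonglongrightarrow> 0)"

end

theory Submission
  imports Defs "HOL-Complex_Analysis.Complex_Analysis"
begin

text \<open>
Suppose that an operator \<open>B\<close> has a functional calculus in which the norm of \<open>g(B)\<close> is at most the
supremum of \<open>\<bar>g\<bar>\<close> over a set \<open>\<Omega>\<close> of complex numbers. Then \<open>t \<parallel>B exp (- t B)\<parallel>\<close> is at most the supremum
of \<open>t \<bar>w\<bar> exp (- t Re w)\<close> over \<open>w\<close> in \<open>\<Omega>\<close>. On the positive half-line this supremum is at most \<open>1 / e\<close>.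
It still tends to at most \<open>1 / e\<close> if \<open>\<Omega>\<close> has a cusp at 0 tangent to the positive half-line and
\<open>\<bar>1 - w\<bar>\<close> stays below 1 by a fixed amount on \<open>\<Omega>\<close> away from 0, which keeps \<open>Re w\<close> away from 0:
as \<open>t\<close> grows only small \<open>w\<close> matter, and these are almost positive. For the same reason the supremum of \<open>n \<bar>w\<bar> \<bar>1 - w\<bar>\<^sup>n\<close> is asymptotically at most \<open>1 / e\<close>. So
\<open>A = - B\<close> and \<open>T = I - B\<close> are as required once \<open>B \<noteq> 0\<close> has such a calculus and spectrum \<open>{0}\<close>. The
scalar estimate is \<open>\<phi>_decay\<close>.

The cusp is the image of the unit disc under \<open>\<phi> z = 1 / (5 - Ln (1 - z))\<close>: the logarithm maps the
disc into a half-strip, and inversion turns the infinite end of the strip into a cusp. The calculus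
is that of the backward shift \<open>L\<close> on \<open>\<ell>\<^sup>2\<close>. As \<open>f(L)\<close> is the transpose of multiplication by \<open>f\<close> on power
series with square-summable coefficients, Parseval's identity on circles bounds the norm of \<open>f(L)\<close> by
the supremum of \<open>\<bar>f\<bar>\<close> over the disc (\<open>conv_bound\<close>, \<open>backshift_bound\<close>), and the calculus is
multiplicative (\<open>backshift_mult\<close>).

On all of \<open>\<ell>\<^sup>2\<close> the operator \<open>\<phi>(L)\<close> has a large spectrum. It is restricted to the kernel of \<open>\<theta>(L)\<close>,
where \<open>\<theta> z = exp (- (1 + z) / (1 - z))\<close> is the singular inner function with its mass at 1, the point
where \<open>\<phi>\<close> vanishes. There only the symbols modulo \<open>\<theta>\<close> matter, and \<open>w - \<phi>\<close> has a bounded inverse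
modulo \<open>\<theta>\<close> for every \<open>w \<noteq> 0\<close>: in the variable \<open>s = Ln (1 - z)\<close> the function \<open>\<theta>\<close> is the restriction of
an entire function without zeros, so that the only possible zero of \<open>w - \<phi>\<close> can be divided out of \<open>1 - c \<theta>\<close>
for a suitable constant \<open>c\<close> (\<open>resolvent_symbol\<close>).

The point 0 is in the spectrum because geometric sequences with ratio near 1, corrected so as to lie in
the kernel of \<open>\<theta>(L)\<close>, are approximate null vectors of \<open>\<phi>(L)\<close> (\<open>approximate_kernel\<close>). The correction
uses that multiplication by \<open>\<theta>\<close> is an isometry (\<open>inner_symbol_isometry\<close>). Finally \<open>\<phi>(L)\<close> is not 0
because it divides the injective operator \<open>1 - L\<close> (\<open>backshift_\<phi>_injective\<close>).
\<close>

section \<open>Square-summable sequences\<close>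

definition l2 :: "(nat \<Rightarrow> complex) set" where
  "l2 = {x. summable (\<lambda>n. (cmod (x n))\<^sup>2)}"

definition l2norm :: "(nat \<Rightarrow> complex) \<Rightarrow> real" where
  "l2norm x = sqrt (\<Sum>n. (cmod (x n))\<^sup>2)"

text \<open>
The pairing is bilinear, without conjugation: transposes with respect to it
commute with complex scalars, so a symbol and its transposed operator have the same
Taylor coefficients.
\<close>

definition l2pair :: "(nat \<Rightarrow> complex) \<Rightarrow> (nat \<Rightarrow> complex) \<Rightarrow> complex" where
  "l2pair x y = (\<Sum>n. x n * y n)"

lemma l2norm_nonneg: "x \<in> l2 \<Longrightarrow> 0 \<le> l2norm x"
  by (simp add: l2norm_def l2_def suminf_nonneg)

lemma l2norm_sq: "x \<in> l2 \<Longrightarrow> (l2norm x)\<^sup>2 = (\<Sum>n. (cmod (x n))\<^sup>2)"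
  by (simp add: l2norm_def l2_def suminf_nonneg)

lemma L2_set_le_l2norm:
  assumes "x \<in> l2" "finite F"
  shows "L2_set (\<lambda>n. cmod (x n)) F \<le> l2norm x"
  using assms by (auto simp: L2_set_def l2norm_def l2_def intro!: sum_le_suminf)

lemma cmod_le_l2norm: "x \<in> l2 \<Longrightarrow> cmod (x n) \<le> l2norm x"
  using L2_set_le_l2norm[of x "{n}"] by simp

text \<open>
Norm bounds are proved for finitely many coordinates at a time, where no convergence
question arises, and are passed to the whole sequence in this way.
\<close>

lemma l2_boundI:
  assumes "\<And>N. L2_set (\<lambda>n. cmod (x n)) {..<N} \<le> M"
  shows "x \<in> l2" and "l2norm x \<le> M"
proof -
  have M: "0 \<le> M"
    using assms[of 0] by simp
  have le: "(\<Sum>n<N. (cmod (x n))\<^sup>2) \<le> M\<^sup>2" for N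
    using assms[of N] by (simp add: L2_set_def real_sqrt_le_iff sqrt_le_D)
  have s: "summable (\<lambda>n. (cmod (x n))\<^sup>2)"
    by (rule summableI_nonneg_bounded[OF _ le]) simp
  then show "x \<in> l2"
    by (simp add: l2_def)
  show "l2norm x \<le> M"
    unfolding l2norm_def using suminf_le_const[OF s le] M
    by (simp add: real_le_lsqrt)
qed

lemma l2norm_eq_0: "x \<in> l2 \<Longrightarrow> l2norm x = 0 \<Longrightarrow> x = (\<lambda>_. 0)"
  using cmod_le_l2norm[of x] by (intro ext) (simp add: order_antisym)

lemma l2_zero: "(\<lambda>_. 0) \<in> l2" "l2norm (\<lambda>_. 0) = 0"
  by (simp_all add: l2_def l2norm_def)

lemma l2_scale:
  assumes "x \<in> l2"
  shows "(\<lambda>n. c * x n) \<in> l2" and "l2norm (\<lambda>n. c * x n) = cmod c * l2norm x"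
  using assms
  by (auto simp: l2_def l2norm_def norm_mult power_mult_distrib suminf_mult real_sqrt_mult
      intro!: summable_mult)

lemma l2_add:
  assumes "x \<in> l2" "y \<in> l2"
  shows "(\<lambda>n. x n + y n) \<in> l2" and "l2norm (\<lambda>n. x n + y n) \<le> l2norm x + l2norm y"
proof -
  have "L2_set (\<lambda>n. cmod (x n + y n)) {..<N} \<le> l2norm x + l2norm y" for N
  proof -
    have "L2_set (\<lambda>n. cmod (x n + y n)) {..<N} \<le> L2_set (\<lambda>n. cmod (x n) + cmod (y n)) {..<N}"
      by (intro L2_set_mono) (auto intro: norm_triangle_ineq)
    also have "\<dots> \<le> L2_set (\<lambda>n. cmod (x n)) {..<N} + L2_set (\<lambda>n. cmod (y n)) {..<N}"
      by (rule L2_set_triangle_ineq)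
    also have "\<dots> \<le> l2norm x + l2norm y"
      using assms by (intro add_mono L2_set_le_l2norm) auto
    finally show ?thesis .
  qed
  from l2_boundI[OF this] show "(\<lambda>n. x n + y n) \<in> l2"
    and "l2norm (\<lambda>n. x n + y n) \<le> l2norm x + l2norm y" by auto
qed

lemma l2_diff:
  assumes "x \<in> l2" "y \<in> l2"
  shows "(\<lambda>n. x n - y n) \<in> l2" and "l2norm (\<lambda>n. x n - y n) \<le> l2norm x + l2norm y"
  using l2_add[OF assms(1) l2_scale(1)[OF assms(2), of "-1"]] l2_scale(2)[OF assms(2), of "-1"]
  by simp_all

lemma l2norm_diff_commute: "l2norm (\<lambda>n. x n - y n) = l2norm (\<lambda>n. y n - x n)"
  by (simp add: l2norm_def norm_minus_commute)

lemma l2norm_reverse_triangle: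
  assumes "x \<in> l2" "y \<in> l2"
  shows "l2norm x - l2norm y \<le> l2norm (\<lambda>n. x n - y n)"
  using l2_add(2)[OF l2_diff(1)[OF assms] assms(2)] by simp

lemma l2_mult_summable:
  assumes "x \<in> l2" "y \<in> l2"
  shows "summable (\<lambda>n. cmod (x n * y n))"
    and "(\<Sum>n. cmod (x n * y n)) \<le> l2norm x * l2norm y"
proof -
  have le: "(\<Sum>n<N. cmod (x n * y n)) \<le> l2norm x * l2norm y" for N
  proof -
    have "(\<Sum>n<N. cmod (x n * y n)) = (\<Sum>n<N. \<bar>cmod (x n)\<bar> * \<bar>cmod (y n)\<bar>)"
      by (simp add: norm_mult)
    also have "\<dots> \<le> L2_set (\<lambda>n. cmod (x n)) {..<N} * L2_set (\<lambda>n. cmod (y n)) {..<N}"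
      by (rule L2_set_mult_ineq)
    also have "\<dots> \<le> l2norm x * l2norm y"
      using assms by (intro mult_mono L2_set_le_l2norm) (auto simp: L2_set_nonneg l2norm_nonneg)
    finally show ?thesis .
  qed
  show s: "summable (\<lambda>n. cmod (x n * y n))"
    by (rule summableI_nonneg_bounded[OF _ le]) simp
  show "(\<Sum>n. cmod (x n * y n)) \<le> l2norm x * l2norm y"
    by (rule suminf_le_const[OF s le])
qed

lemma l2pair_summable: "x \<in> l2 \<Longrightarrow> y \<in> l2 \<Longrightarrow> summable (\<lambda>n. x n * y n)"
  by (rule summable_norm_cancel[OF l2_mult_summable(1)])

lemma l2pair_bound: "x \<in> l2 \<Longrightarrow> y \<in> l2 \<Longrightarrow> cmod (l2pair x y) \<le> l2norm x * l2norm y"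
  unfolding l2pair_def
  by (rule order_trans[OF summable_norm[OF l2_mult_summable(1)] l2_mult_summable(2)])

lemma l2pair_diff_right:
  "x \<in> l2 \<Longrightarrow> y \<in> l2 \<Longrightarrow> z \<in> l2 \<Longrightarrow>
    l2pair x (\<lambda>n. y n - z n) = l2pair x y - l2pair x z"
  unfolding l2pair_def by (simp add: suminf_diff[symmetric] l2pair_summable algebra_simps)

lemma l2_cnj: "x \<in> l2 \<Longrightarrow> (\<lambda>n. cnj (x n)) \<in> l2"
  by (simp add: l2_def)

definition cutoff :: "nat \<Rightarrow> (nat \<Rightarrow> complex) \<Rightarrow> nat \<Rightarrow> complex" where
  "cutoff N x = (\<lambda>n. if n < N then x n else 0)"

lemma cutoff_l2norm: "cutoff N x \<in> l2" "l2norm (cutoff N x) = L2_set (\<lambda>n. cmod (x n)) {..<N}"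
proof -
  have eq: "(\<lambda>n. (cmod (cutoff N x n))\<^sup>2) = (\<lambda>n. if n < N then (cmod (x n))\<^sup>2 else 0)"
    by (auto simp: cutoff_def)
  have "(\<lambda>n. (cmod (cutoff N x n))\<^sup>2) sums (\<Sum>n | n < N. (cmod (x n))\<^sup>2)"
    unfolding eq by (rule sums_If_finite) simp
  then show "cutoff N x \<in> l2" "l2norm (cutoff N x) = L2_set (\<lambda>n. cmod (x n)) {..<N}"
    by (auto simp: l2_def l2norm_def L2_set_def sums_iff lessThan_def)
qed

lemma cutoff_tendsto:
  assumes "x \<in> l2"
  shows "(\<lambda>N. l2norm (\<lambda>n. x n - cutoff N x n)) \<longlonglongrightarrow> 0"
proof -
  let ?a = "\<lambda>n. (cmod (x n))\<^sup>2"
  have a: "summable ?a"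
    using assms by (simp add: l2_def)
  have "l2norm (\<lambda>n. x n - cutoff N x n) = sqrt (suminf ?a - sum ?a {..<N})" for N
  proof -
    have "(\<lambda>n. (cmod (x n - cutoff N x n))\<^sup>2) = (\<lambda>n. ?a n - (if n < N then ?a n else 0))"
      by (auto simp: cutoff_def)
    moreover have "(\<lambda>n. ?a n - (if n < N then ?a n else 0)) sums (suminf ?a - (\<Sum>n | n < N. ?a n))"
      by (intro sums_diff summable_sums a sums_If_finite) simp
    ultimately show ?thesis
      by (simp add: l2norm_def sums_iff lessThan_def)
  qed
  moreover have "(\<lambda>N. sqrt (suminf ?a - sum ?a {..<N})) \<longlonglongrightarrow> sqrt (suminf ?a - suminf ?a)"
    by (intro tendsto_intros summable_LIMSEQ a)
  ultimately show ?thesis by simp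
qed

text \<open>
The coordinatewise limit is the limit in norm: the Cauchy estimate holds for each
finite set of coordinates and survives the passage to the limit there.
\<close>

lemma l2_complete:
  assumes X: "\<And>n. X n \<in> l2"
    and cauchy: "\<And>e. e > 0 \<Longrightarrow> \<exists>N. \<forall>m\<ge>N. \<forall>n\<ge>N. l2norm (\<lambda>k. X m k - X n k) < e"
  obtains x where "x \<in> l2" "(\<lambda>n. l2norm (\<lambda>k. X n k - x k)) \<longlonglongrightarrow> 0"
proof -
  have "Cauchy (\<lambda>n. X n k)" for k
  proof (rule metric_CauchyI)
    fix e :: real assume "e > 0"
    from cauchy[OF this] obtain N where N: "\<And>m n. m \<ge> N \<Longrightarrow> n \<ge> N \<Longrightarrow> l2norm (\<lambda>k. X m k - X n k) < e"
      by blast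
    have "dist (X m k) (X n k) < e" if "m \<ge> N" "n \<ge> N" for m n
      using cmod_le_l2norm[OF l2_diff(1)[OF X[of m] X[of n]], of k] N[OF that] by (simp add: dist_norm)
    then show "\<exists>M. \<forall>m\<ge>M. \<forall>n\<ge>M. dist (X m k) (X n k) < e" by blast
  qed
  then have "\<exists>l. (\<lambda>n. X n k) \<longlonglongrightarrow> l" for k
    using Cauchy_convergent_iff convergent_def by blast
  then obtain x where x: "\<And>k. (\<lambda>n. X n k) \<longlonglongrightarrow> x k" by metis
  have close: "\<exists>N. \<forall>n\<ge>N. (\<lambda>k. X n k - x k) \<in> l2 \<and> l2norm (\<lambda>k. X n k - x k) \<le> e" if "e > 0" for e
  proof -
    from cauchy[OF that] obtain N where N: "\<And>m n. m \<ge> N \<Longrightarrow> n \<ge> N \<Longrightarrow> l2norm (\<lambda>k. X m k - X n k) < e"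
      by blast
    have "L2_set (\<lambda>k. cmod (X n k - x k)) {..<J} \<le> e" if n: "n \<ge> N" for n J
    proof (rule LIMSEQ_le_const2)
      show "(\<lambda>m. L2_set (\<lambda>k. cmod (X n k - X m k)) {..<J}) \<longlonglongrightarrow> L2_set (\<lambda>k. cmod (X n k - x k)) {..<J}"
        unfolding L2_set_def by (intro tendsto_intros x)
      show "\<exists>M. \<forall>m\<ge>M. L2_set (\<lambda>k. cmod (X n k - X m k)) {..<J} \<le> e"
        using L2_set_le_l2norm[OF l2_diff(1)[OF X X]] N[OF n] by (meson finite_lessThan less_imp_le order_trans)
    qed
    then show ?thesis by (intro exI[of _ N] allI impI conjI l2_boundI)
  qed
  have xl2: "x \<in> l2"
  proof -
    obtain n where "(\<lambda>k. X n k - x k) \<in> l2" using close[of 1] by auto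
    from l2_diff(1)[OF X[of n] this] show ?thesis by simp
  qed
  moreover have "(\<lambda>n. l2norm (\<lambda>k. X n k - x k)) \<longlonglongrightarrow> 0"
  proof (rule LIMSEQ_I)
    fix e :: real assume "e > 0"
    with close[of "e/2"] obtain N where "\<forall>n\<ge>N. l2norm (\<lambda>k. X n k - x k) \<le> e/2" by auto
    with \<open>e > 0\<close> show "\<exists>N. \<forall>n\<ge>N. norm (l2norm (\<lambda>k. X n k - x k) - 0) < e"
      using l2norm_nonneg[OF l2_diff(1)[OF X xl2]] by (intro exI[of _ N]) fastforce
  qed
  ultimately show ?thesis using that by blast
qed

section \<open>Multiplication by bounded analytic functions\<close>

definition coef :: "(complex \<Rightarrow> complex) \<Rightarrow> nat \<Rightarrow> complex" where
  "coef f k = fps_nth (fps_expansion f 0) k"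

definition bounded_symbol :: "(complex \<Rightarrow> complex) \<Rightarrow> real \<Rightarrow> bool" where
  "bounded_symbol f M \<longleftrightarrow> f holomorphic_on ball 0 1 \<and> (\<forall>z\<in>ball 0 1. cmod (f z) \<le> M)"

definition conv :: "(nat \<Rightarrow> complex) \<Rightarrow> (nat \<Rightarrow> complex) \<Rightarrow> nat \<Rightarrow> complex" where
  "conv a y m = (\<Sum>i\<le>m. a i * y (m - i))"

lemma coef_sums:
  assumes "f holomorphic_on ball 0 1" "z \<in> ball 0 1"
  shows "(\<lambda>k. coef f k * z ^ k) sums f z"
  using holomorphic_power_series[OF assms] by (simp add: coef_def fps_expansion_def)

lemma has_fps_expansion_symbol:
  assumes "f holomorphic_on ball 0 1"
  shows "f has_fps_expansion fps_expansion f 0"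
  by (rule has_fps_expansion_fps_expansion[of "ball 0 1"]) (use assms in auto)

text \<open>
Products of functions are convolutions of Taylor coefficients. This is what makes the
functional calculus multiplicative.
\<close>

lemma coef_mult:
  assumes "f holomorphic_on ball 0 1" "g holomorphic_on ball 0 1"
  shows "coef (\<lambda>z. f z * g z) = conv (coef f) (coef g)"
proof -
  have "fps_expansion (\<lambda>z. f z * g z) 0 = fps_expansion f 0 * fps_expansion g 0"
    by (intro fps_expansion_eqI has_fps_expansion_mult has_fps_expansion_symbol assms)
  then show ?thesis
    by (auto simp: coef_def fps_mult_nth conv_def atMost_atLeast0)
qed

lemma coef_add:
  assumes "f holomorphic_on ball 0 1" "g holomorphic_on ball 0 1"
  shows "coef (\<lambda>z. f z + g z) k = coef f k + coef g k"
proof -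
  have "fps_expansion (\<lambda>z. f z + g z) 0 = fps_expansion f 0 + fps_expansion g 0"
    by (intro fps_expansion_eqI has_fps_expansion_add has_fps_expansion_symbol assms)
  then show ?thesis
    by (simp add: coef_def)
qed

lemma coef_const: "coef (\<lambda>z. c) k = (if k = 0 then c else 0)"
proof -
  have "fps_expansion (\<lambda>z. c) 0 = fps_const c"
    by (intro fps_expansion_eqI) auto
  then show ?thesis by (simp add: coef_def)
qed

lemma coef_id: "coef (\<lambda>z. z) k = (if k = 1 then 1 else 0)"
proof -
  have "fps_expansion (\<lambda>z. z) 0 = fps_X"
    by (intro fps_expansion_eqI has_fps_expansion_fps_X)
  then show ?thesis by (simp add: coef_def fps_X_def)
qed

text \<open>
Convolution is the multiplication of formal power series, from which its ring laws
are inherited.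
\<close>

lemma conv_assoc: "conv (conv a b) y = conv a (conv b y)"
proof -
  have "Abs_fps (conv a y) = Abs_fps a * Abs_fps y" for a y
    by (simp add: fps_eq_iff fps_mult_nth conv_def atMost_atLeast0)
  then have "Abs_fps (conv (conv a b) y) = Abs_fps (conv a (conv b y))"
    by (simp add: mult.assoc)
  then show ?thesis
    by (simp add: Abs_fps_inject)
qed

lemma conv_commute: "conv a b = conv b a"
proof -
  have "Abs_fps (conv a y) = Abs_fps a * Abs_fps y" for a y
    by (simp add: fps_eq_iff fps_mult_nth conv_def atMost_atLeast0)
  then have "Abs_fps (conv a b) = Abs_fps (conv b a)"
    by (simp add: mult.commute)
  then show ?thesis
    by (simp add: Abs_fps_inject)
qed

lemma has_integral_cis:
  fixes j :: int
  shows "((\<lambda>t. cis (2 * pi * j * t)) has_integral (if j = 0 then 1 else 0)) {0..1}"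
proof (cases "j = 0")
  case True
  then show ?thesis using has_integral_const_real[of "1::complex" 0 1] by simp
next
  case False
  define w where "w = 2 * of_real pi * \<i> * of_int j"
  have w: "w \<noteq> 0" using False by (simp add: w_def)
  have cis: "cis (2 * pi * j * t) = exp (w * of_real t)" for t
    by (simp add: w_def cis_conv_exp mult_ac)
  have "((\<lambda>t. exp (w * of_real t)) has_integral (exp (w * of_real 1) / w - exp (w * of_real 0) / w)) {0..1}"
  proof (rule fundamental_theorem_of_calculus)
    fix x :: real
    have "((\<lambda>z. exp (w * z) / w) has_field_derivative exp (w * of_real x)) (at (of_real x))"
      using w by (auto intro!: derivative_eq_intros)
    then show "((\<lambda>t. exp (w * of_real t) / w) has_vector_derivative exp (w * of_real x)) (at x within {0..1})"
      by (rule has_vector_derivative_real_field)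
  qed simp
  moreover have "exp (w * of_real 1) = 1"
    using cis[of 1] cis_multiple_2pi[of "real_of_int j"] by (simp add: mult_ac)
  ultimately show ?thesis
    using False by (simp add: cis)
qed

lemma has_integral_trig_poly:
  "((\<lambda>t. (cmod (\<Sum>k<N. b k * cis (2 * pi * t) ^ k))\<^sup>2) has_integral (\<Sum>k<N. (cmod (b k))\<^sup>2)) {0..1}"
proof -
  have eq: "(cmod (\<Sum>k<N. b k * cis (2 * pi * t) ^ k))\<^sup>2
      = (\<Sum>k<N. \<Sum>l<N. Re (b k * cnj (b l) * cis (2 * pi * (int k - int l) * t)))" for t
  proof -
    have c: "cis (2 * pi * t) ^ k * cnj (cis (2 * pi * t) ^ l) = cis (2 * pi * (int k - int l) * t)" for k l
      unfolding complex_cnj_power cis_cnj Complex.DeMoivre cis_mult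
      by (rule arg_cong[where f = cis]) (simp add: algebra_simps)
    have "(cmod (\<Sum>k<N. b k * cis (2 * pi * t) ^ k))\<^sup>2
        = Re ((\<Sum>k<N. b k * cis (2 * pi * t) ^ k) * cnj (\<Sum>k<N. b k * cis (2 * pi * t) ^ k))"
      by (metis Re_complex_of_real complex_norm_square)
    also have "\<dots> = Re (\<Sum>k<N. \<Sum>l<N. (b k * cis (2 * pi * t) ^ k) * cnj (b l * cis (2 * pi * t) ^ l))"
      by (simp add: sum_product)
    also have "\<dots> = Re (\<Sum>k<N. \<Sum>l<N. b k * cnj (b l) * cis (2 * pi * (int k - int l) * t))"
      unfolding c[symmetric] by (simp add: mult_ac)
    finally show ?thesis by simp
  qed
  have one: "((\<lambda>t. Re (b k * cnj (b l) * cis (2 * pi * (int k - int l) * t)))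
      has_integral (if k = l then (cmod (b k))\<^sup>2 else 0)) {0..1}" for k l
  proof -
    have "((\<lambda>t. b k * cnj (b l) * cis (2 * pi * (int k - int l) * t))
      has_integral (b k * cnj (b l) * (if int k - int l = 0 then 1 else 0))) {0..1}"
      by (rule has_integral_mult_right[OF has_integral_cis])
    from has_integral_linear[OF this bounded_linear_Re] show ?thesis
      by (auto simp: o_def cmod_power2 simp flip: power2_eq_square split: if_splits)
  qed
  have "((\<lambda>t. \<Sum>k<N. \<Sum>l<N. Re (b k * cnj (b l) * cis (2 * pi * (int k - int l) * t)))
      has_integral (\<Sum>k<N. \<Sum>l<N. if k = l then (cmod (b k))\<^sup>2 else 0)) {0..1}"
    by (intro has_integral_sum one) auto
  then show ?thesis
    unfolding eq by simp
qed

lemma circle_point_in_ball: "0 \<le> r \<Longrightarrow> r < 1 \<Longrightarrow> complex_of_real r * cis \<theta> \<in> ball 0 1"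
  by (simp add: norm_mult)

lemma integrable_on_circle:
  assumes "f holomorphic_on ball 0 1" "0 \<le> r" "r < 1"
  shows "(\<lambda>t. (cmod (f (of_real r * cis (2 * pi * t))))\<^sup>2) integrable_on {0..1}"
proof -
  have "continuous_on {0..1} (\<lambda>t. f (of_real r * cis (2 * pi * t)))"
    by (rule continuous_on_compose2[OF holomorphic_on_imp_continuous_on[OF assms(1)]])
       (use assms in \<open>auto intro!: continuous_intros circle_point_in_ball simp: norm_mult\<close>)
  then show ?thesis
    by (intro integrable_continuous_real continuous_intros)
qed

text \<open>
Orthogonality of the characters gives the identity for Taylor polynomials; on a circle
of radius less than 1 the Taylor series converges absolutely and dominates its partial
sums, so the integrals converge.
\<close>

lemma parseval_circle:
  assumes f: "f holomorphic_on ball 0 1" and r: "0 \<le> r" "r < 1"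
  shows "(\<lambda>k. (cmod (coef f k * of_real r ^ k))\<^sup>2) sums
    integral {0..1} (\<lambda>t. (cmod (f (of_real r * cis (2 * pi * t))))\<^sup>2)"
proof -
  define b where "b k = coef f k * of_real r ^ k" for k
  define P where "P N t = (\<Sum>k<N. b k * cis (2 * pi * t) ^ k)" for N t
  have P_eq: "P N t = (\<Sum>k<N. coef f k * (of_real r * cis (2 * pi * t)) ^ k)" for N t
    by (simp add: P_def b_def power_mult_distrib mult_ac)
  have sb: "summable (\<lambda>k. cmod (b k))"
  proof -
    obtain q where q: "r < q" "q < 1" using dense r by blast
    have "summable (\<lambda>k. coef f k * of_real q ^ k)"
      using coef_sums[OF f, of "of_real q"] q r by (simp add: sums_iff)
    then show ?thesis
      unfolding b_def by (rule powser_insidea) (use q r in simp)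
  qed
  have bound: "cmod (P N t) \<le> (\<Sum>k. cmod (b k))" for N t
  proof -
    have "cmod (P N t) \<le> (\<Sum>k<N. cmod (b k * cis (2 * pi * t) ^ k))"
      unfolding P_def by (rule norm_sum)
    also have "\<dots> = (\<Sum>k<N. cmod (b k))"
      by (simp add: norm_mult norm_power)
    also have "\<dots> \<le> (\<Sum>k. cmod (b k))"
      by (rule sum_le_suminf[OF sb]) auto
    finally show ?thesis .
  qed
  have "(\<lambda>N. integral {0..1} (\<lambda>t. (cmod (P N t))\<^sup>2)) \<longlonglongrightarrow>
      integral {0..1} (\<lambda>t. (cmod (f (of_real r * cis (2 * pi * t))))\<^sup>2)"
  proof (rule dominated_convergence(2))
    show "(\<lambda>t. (cmod (P N t))\<^sup>2) integrable_on {0..1}" for N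
      unfolding P_def using has_integral_trig_poly by blast
    show "(\<lambda>t::real. (\<Sum>k. cmod (b k))\<^sup>2) integrable_on {0..1}"
      by (rule integrable_const_ivl)
    show "norm ((cmod (P N t))\<^sup>2) \<le> (\<Sum>k. cmod (b k))\<^sup>2" for N t
      using bound[of N t] by (simp add: power_mono)
    show "(\<lambda>N. (cmod (P N t))\<^sup>2) \<longlonglongrightarrow> (cmod (f (of_real r * cis (2 * pi * t))))\<^sup>2" for t
      using coef_sums[OF f circle_point_in_ball[OF r]]
      unfolding P_eq sums_def by (intro tendsto_intros)
  qed
  moreover have "integral {0..1} (\<lambda>t. (cmod (P N t))\<^sup>2) = (\<Sum>k<N. (cmod (b k))\<^sup>2)" for N
    unfolding P_def by (rule integral_unique[OF has_integral_trig_poly])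
  ultimately show ?thesis
    by (simp add: sums_def b_def)
qed

text \<open>
Square-summable coefficients are bounded, hence their power series converges in the disc.
\<close>

lemma l2_generating_function:
  assumes "y \<in> l2"
  obtains Y where "Y holomorphic_on ball 0 1" "coef Y = y"
proof -
  let ?F = "Abs_fps y"
  have "1 \<le> conv_radius y"
  proof (rule conv_radius_geI_ex')
    fix r :: real assume r: "0 < r" "ereal r < 1"
    then have "summable (\<lambda>n. l2norm y * r ^ n)"
      by (intro summable_mult summable_geometric) simp
    then show "summable (\<lambda>n. y n * of_real r ^ n)"
      by (rule summable_comparison_test'[where N = 0])
         (use r cmod_le_l2norm[OF assms] in \<open>auto simp: norm_mult norm_power intro!: mult_right_mono\<close>)
  qed
  then have rad: "1 \<le> fps_conv_radius ?F"
    by (simp add: fps_conv_radius_def)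
  have "eval_fps ?F holomorphic_on ball 0 1"
    by (rule holomorphic_on_eval_fps)
       (use rad in \<open>auto simp: one_ereal_def intro!: order.strict_trans2[OF _ rad]\<close>)
  moreover have "fps_expansion (eval_fps ?F) 0 = ?F"
    by (rule fps_expansion_eqI, rule eval_fps_has_fps_expansion)
       (use rad in \<open>auto intro!: order.strict_trans2[OF _ rad]\<close>)
  ultimately show ?thesis
    using that[of "eval_fps ?F"] by (auto simp: coef_def fun_eq_iff)
qed

lemma L2_set_le_of_radii:
  assumes "0 \<le> C"
    and "\<And>r. 0 \<le> r \<Longrightarrow> r < 1 \<Longrightarrow> (\<Sum>k<N. (cmod (a k * of_real r ^ k))\<^sup>2) \<le> C\<^sup>2"
  shows "L2_set (\<lambda>k. cmod (a k)) {..<N} \<le> C"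
proof -
  define r where "r n = 1 - 1 / (real n + 1)" for n
  have "(\<lambda>n. \<Sum>k<N. (cmod (a k * of_real (r n) ^ k))\<^sup>2) \<longlonglongrightarrow> (\<Sum>k<N. (cmod (a k * of_real 1 ^ k))\<^sup>2)"
  proof (intro tendsto_intros)
    show "r \<longlonglongrightarrow> 1"
      unfolding r_def by real_asymp
  qed
  then have "(\<Sum>k<N. (cmod (a k * of_real 1 ^ k))\<^sup>2) \<le> C\<^sup>2"
    by (rule LIMSEQ_le_const2) (use assms(2)[of "r _"] in \<open>auto simp: r_def\<close>)
  then show ?thesis
    using assms(1) by (simp add: L2_set_def real_le_lsqrt)
qed

lemma bounded_symbol_nonneg: "bounded_symbol f M \<Longrightarrow> 0 \<le> M"
  unfolding bounded_symbol_def using norm_ge_zero order_trans by (metis centre_in_ball zero_less_one)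

text \<open>
Multiplication by a function bounded by \<open>M\<close> has norm at most \<open>M\<close> on \<open>\<ell>\<^sup>2\<close>. On each circle
of radius \<open>r < 1\<close> the pointwise bound integrates, by Parseval, to a bound for the
coefficients weighted by powers of \<open>r\<close>; then \<open>r\<close> tends to 1.
\<close>

theorem conv_bound:
  assumes f: "bounded_symbol f M" and y: "y \<in> l2"
  shows "conv (coef f) y \<in> l2" and "l2norm (conv (coef f) y) \<le> M * l2norm y"
proof -
  have hol: "f holomorphic_on ball 0 1" and bd: "\<And>z. z \<in> ball 0 1 \<Longrightarrow> cmod (f z) \<le> M"
    using f by (auto simp: bounded_symbol_def)
  have M: "0 \<le> M" by (rule bounded_symbol_nonneg[OF f])
  obtain Y where Y: "Y holomorphic_on ball 0 1" "coef Y = y"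
    by (rule l2_generating_function[OF y])
  have cY: "coef (\<lambda>z. f z * Y z) = conv (coef f) y"
    by (simp add: coef_mult[OF hol Y(1)] Y(2))
  have "(\<Sum>k<N. (cmod (conv (coef f) y k * of_real r ^ k))\<^sup>2) \<le> (M * l2norm y)\<^sup>2"
    if r: "0 \<le> r" "r < 1" for r N
  proof -
    let ?c = "\<lambda>t. of_real r * cis (2 * pi * t)"
    have holfY: "(\<lambda>z. f z * Y z) holomorphic_on ball 0 1"
      by (intro holomorphic_intros hol Y(1))
    note par = parseval_circle[OF holfY r, unfolded cY]
    note parY = parseval_circle[OF Y(1) r, unfolded Y(2)]
    have "(\<Sum>k<N. (cmod (conv (coef f) y k * of_real r ^ k))\<^sup>2)
        \<le> (\<Sum>k. (cmod (conv (coef f) y k * of_real r ^ k))\<^sup>2)"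
      using par by (intro sum_le_suminf) (auto simp: sums_iff)
    also have "\<dots> = integral {0..1} (\<lambda>t. (cmod (f (?c t) * Y (?c t)))\<^sup>2)"
      using par by (simp add: sums_iff)
    also have "\<dots> \<le> integral {0..1} (\<lambda>t. M\<^sup>2 * (cmod (Y (?c t)))\<^sup>2)"
    proof (rule integral_le)
      show "(\<lambda>t. (cmod (f (?c t) * Y (?c t)))\<^sup>2) integrable_on {0..1}"
        by (rule integrable_on_circle[OF holfY r])
      show "(\<lambda>t. M\<^sup>2 * (cmod (Y (?c t)))\<^sup>2) integrable_on {0..1}"
        by (rule integrable_on_mult_right[OF integrable_on_circle[OF Y(1) r]])
      show "(cmod (f (?c t) * Y (?c t)))\<^sup>2 \<le> M\<^sup>2 * (cmod (Y (?c t)))\<^sup>2" for t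
        using bd[OF circle_point_in_ball[OF r]]
        by (auto simp: norm_mult power_mult_distrib intro!: mult_right_mono power_mono)
    qed
    also have "\<dots> = M\<^sup>2 * (\<Sum>k. (cmod (y k * of_real r ^ k))\<^sup>2)"
      using parY by (simp add: sums_iff)
    also have "\<dots> \<le> M\<^sup>2 * (\<Sum>k. (cmod (y k))\<^sup>2)"
    proof (intro mult_left_mono suminf_le)
      show "summable (\<lambda>k. (cmod (y k * of_real r ^ k))\<^sup>2)"
        using parY by (simp add: sums_iff)
      show "summable (\<lambda>k. (cmod (y k))\<^sup>2)"
        using y by (simp add: l2_def)
      show "(cmod (y k * of_real r ^ k))\<^sup>2 \<le> (cmod (y k))\<^sup>2" for k
        using r by (intro power_mono) (auto simp: norm_mult norm_power intro!: mult_right_le_one_le power_le_one)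
    qed auto
    finally show ?thesis
      by (simp add: power_mult_distrib l2norm_sq[OF y])
  qed
  then have "L2_set (\<lambda>k. cmod (conv (coef f) y k)) {..<N} \<le> M * l2norm y" for N
    by (intro L2_set_le_of_radii) (auto simp: M l2norm_nonneg[OF y])
  from l2_boundI[OF this] show "conv (coef f) y \<in> l2" and "l2norm (conv (coef f) y) \<le> M * l2norm y"
    by auto
qed

section \<open>Functional calculus of the backward shift\<close>

definition unit_seq :: "nat \<Rightarrow> nat \<Rightarrow> complex" where
  "unit_seq n m = (if m = n then 1 else 0)"

text \<open>
The operator \<open>f(L)\<close>, where \<open>L\<close> is the backward shift: the \<open>n\<close>-th coordinate is the sum of
\<open>f\<^sub>k x\<^sub>n\<^sub>+\<^sub>k\<close> over \<open>k\<close>, with \<open>f\<^sub>k\<close> the Taylor coefficients of \<open>f\<close>. Written as a pairing with the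
shifted coefficient sequence, it is visibly the transpose of multiplication by \<open>f\<close>.
\<close>

definition backshift :: "(complex \<Rightarrow> complex) \<Rightarrow> (nat \<Rightarrow> complex) \<Rightarrow> nat \<Rightarrow> complex" where
  "backshift f x n = l2pair x (conv (coef f) (unit_seq n))"

lemma unit_seq_sums: "(\<lambda>m. x m * unit_seq n m) sums x n"
  using sums_single[of n x] by (simp add: unit_seq_def if_distrib cong: if_cong)

lemma l2pair_unit_seq: "l2pair x (unit_seq n) = x n"
  unfolding l2pair_def using unit_seq_sums by (rule sums_unique[symmetric])

lemma unit_seq_l2: "unit_seq n \<in> l2"
proof -
  have "(\<lambda>m. (cmod (unit_seq n m))\<^sup>2) = (\<lambda>m. if m = n then 1 else 0)"
    by (auto simp: unit_seq_def)
  then show ?thesis by (simp add: l2_def)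
qed

lemma conv_unit_seq: "conv a (unit_seq n) m = (if n \<le> m then a (m - n) else 0)"
proof -
  have "conv a (unit_seq n) m = (\<Sum>i\<le>m. if i = m - n then (if n \<le> m then a i else 0) else 0)"
    unfolding conv_def by (intro sum.cong) (auto simp: unit_seq_def)
  then show ?thesis by simp
qed

lemma conv_diff: "conv a (\<lambda>n. y n - z n) = (\<lambda>n. conv a y n - conv a z n)"
  by (auto simp: conv_def right_diff_distrib sum_subtractf)

lemma conv_cutoff: "conv a (cutoff N y) m = (\<Sum>n<N. y n * conv a (unit_seq n) m)"
proof -
  have c: "cutoff N y k = (\<Sum>n<N. y n * unit_seq n k)" for k
    by (simp add: cutoff_def unit_seq_def if_distrib cong: if_cong)
  show ?thesis
    by (simp add: conv_def c sum_distrib_left sum.swap[of _ "{..<N}"] mult_ac)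
qed

lemma l2pair_cutoff_right: "l2pair x (cutoff N y) = (\<Sum>n<N. x n * y n)"
proof -
  have "(\<lambda>n. x n * cutoff N y n) = (\<lambda>n. if n < N then x n * y n else 0)"
    by (auto simp: cutoff_def)
  moreover have "(\<lambda>n. if n < N then x n * y n else 0) sums (\<Sum>n | n < N. x n * y n)"
    by (rule sums_If_finite) simp
  ultimately show ?thesis
    by (simp add: l2pair_def sums_iff lessThan_def)
qed

lemma conv_unit_seq_l2: "bounded_symbol f M \<Longrightarrow> conv (coef f) (unit_seq n) \<in> l2"
  by (rule conv_bound(1)[OF _ unit_seq_l2])

lemma coef_l2:
  assumes "bounded_symbol f M"
  shows "coef f \<in> l2"
proof -
  have "conv (coef f) (unit_seq 0) = coef f"
    by (auto simp: conv_unit_seq)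
  with conv_unit_seq_l2[OF assms, of 0] show ?thesis by simp
qed

text \<open>
The transposition rule for finitely supported sequences, where the sums can be
interchanged freely.
\<close>

lemma l2pair_conv_cutoff:
  assumes "bounded_symbol f M" "x \<in> l2"
  shows "l2pair x (conv (coef f) (cutoff N y)) = l2pair (backshift f x) (cutoff N y)"
proof -
  have "l2pair x (conv (coef f) (cutoff N y))
      = (\<Sum>m. \<Sum>n<N. y n * (x m * conv (coef f) (unit_seq n) m))"
    unfolding l2pair_def conv_cutoff by (simp add: sum_distrib_left mult_ac)
  also have "\<dots> = (\<Sum>n<N. \<Sum>m. y n * (x m * conv (coef f) (unit_seq n) m))"
    by (intro suminf_sum summable_mult l2pair_summable assms conv_unit_seq_l2[OF assms(1)])
  also have "\<dots> = (\<Sum>n<N. y n * backshift f x n)"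
    unfolding backshift_def l2pair_def
    by (intro sum.cong refl suminf_mult l2pair_summable assms conv_unit_seq_l2[OF assms(1)])
  finally show ?thesis
    by (simp add: l2pair_cutoff_right mult_ac)
qed

text \<open>
A transpose has the norm of the original operator. Pairing \<open>f(L) x\<close> with the conjugate of its
own first \<open>N\<close> coordinates gives the sum of their squares, and transposing moves \<open>f\<close> to the
finitely supported side, where multiplication by \<open>f\<close> is already bounded.
\<close>

theorem backshift_bound:
  assumes f: "bounded_symbol f M" and x: "x \<in> l2"
  shows "backshift f x \<in> l2" and "l2norm (backshift f x) \<le> M * l2norm x"
proof -
  have "L2_set (\<lambda>n. cmod (backshift f x n)) {..<N} \<le> M * l2norm x" for N
  proof -
    define S where "S = L2_set (\<lambda>n. cmod (backshift f x n)) {..<N}"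
    define y where "y n = cnj (backshift f x n)" for n
    have ny: "l2norm (cutoff N y) = S"
      by (simp add: cutoff_l2norm S_def y_def)
    have "l2pair (backshift f x) (cutoff N y) = of_real (\<Sum>n<N. (cmod (backshift f x n))\<^sup>2)"
      by (simp add: l2pair_cutoff_right y_def complex_norm_square[symmetric])
    also have "(\<Sum>n<N. (cmod (backshift f x n))\<^sup>2) = S\<^sup>2"
      by (simp add: S_def L2_set_def sum_nonneg)
    finally have "S\<^sup>2 = cmod (l2pair x (conv (coef f) (cutoff N y)))"
      by (simp add: l2pair_conv_cutoff[OF f x] norm_power S_def)
    also have "\<dots> \<le> l2norm x * l2norm (conv (coef f) (cutoff N y))"
      by (intro l2pair_bound x conv_bound(1)[OF f] cutoff_l2norm)
    also have "\<dots> \<le> l2norm x * (M * S)"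
      using conv_bound(2)[OF f cutoff_l2norm(1), of N y]
      by (intro mult_left_mono l2norm_nonneg x) (simp add: ny)
    finally have le: "S * S \<le> (M * l2norm x) * S"
      by (simp add: power2_eq_square mult_ac)
    have "0 \<le> S"
      by (simp add: S_def L2_set_nonneg)
    moreover have "0 \<le> M * l2norm x"
      by (simp add: bounded_symbol_nonneg[OF f] l2norm_nonneg[OF x])
    ultimately show ?thesis
      using le unfolding S_def[symmetric] by (cases "S = 0") (auto simp: mult_le_cancel_right)
  qed
  from l2_boundI[OF this] show "backshift f x \<in> l2" and "l2norm (backshift f x) \<le> M * l2norm x"
    by auto
qed

lemma l2pair_tendsto:
  assumes x: "x \<in> l2" and y: "y \<in> l2" and Y: "\<And>N. Y N \<in> l2"
    and lim: "(\<lambda>N. l2norm (\<lambda>n. y n - Y N n)) \<longlonglongrightarrow> 0"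
  shows "(\<lambda>N. l2pair x (Y N)) \<longlonglongrightarrow> l2pair x y"
proof (rule Lim_transform2[OF tendsto_const], rule Lim_null_comparison)
  show "\<forall>\<^sub>F N in sequentially. norm (l2pair x y - l2pair x (Y N)) \<le> l2norm x * l2norm (\<lambda>n. y n - Y N n)"
    using l2pair_bound[OF x l2_diff(1)[OF y Y]] by (simp add: l2pair_diff_right x y Y)
  show "(\<lambda>N. l2norm x * l2norm (\<lambda>n. y n - Y N n)) \<longlonglongrightarrow> 0"
    using tendsto_mult_left[OF lim, of "l2norm x"] by simp
qed

text \<open>
Both sides are continuous in \<open>y\<close>, and they agree on finitely supported sequences.
\<close>

theorem backshift_adjoint:
  assumes f: "bounded_symbol f M" and x: "x \<in> l2" and y: "y \<in> l2"
  shows "l2pair (backshift f x) y = l2pair x (conv (coef f) y)"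
proof (rule LIMSEQ_unique)
  show "(\<lambda>N. l2pair (backshift f x) (cutoff N y)) \<longlonglongrightarrow> l2pair (backshift f x) y"
    by (intro l2pair_tendsto backshift_bound(1)[OF f x] y cutoff_l2norm(1) cutoff_tendsto)
  have "(\<lambda>N. l2pair x (conv (coef f) (cutoff N y))) \<longlonglongrightarrow> l2pair x (conv (coef f) y)"
  proof (intro l2pair_tendsto x conv_bound(1)[OF f] y cutoff_l2norm(1))
    show "(\<lambda>N. l2norm (\<lambda>n. conv (coef f) y n - conv (coef f) (cutoff N y) n)) \<longlonglongrightarrow> 0"
    proof (rule Lim_null_comparison)
      show "(\<lambda>N. M * l2norm (\<lambda>n. y n - cutoff N y n)) \<longlonglongrightarrow> 0"
        using tendsto_mult_left[OF cutoff_tendsto[OF y], of M] by simp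
      show "\<forall>\<^sub>F N in sequentially. norm (l2norm (\<lambda>n. conv (coef f) y n - conv (coef f) (cutoff N y) n))
          \<le> M * l2norm (\<lambda>n. y n - cutoff N y n)"
        using conv_bound[OF f l2_diff(1)[OF y cutoff_l2norm(1)]]
        by (simp add: conv_diff[symmetric] l2norm_nonneg)
    qed
  qed
  then show "(\<lambda>N. l2pair (backshift f x) (cutoff N y)) \<longlonglongrightarrow> l2pair x (conv (coef f) y)"
    by (simp add: l2pair_conv_cutoff[OF f x])
qed

lemma bounded_symbol_mult:
  assumes "bounded_symbol f M" "bounded_symbol g N"
  shows "bounded_symbol (\<lambda>z. f z * g z) (M * N)"
  using assms bounded_symbol_nonneg[OF assms(1)]
  by (auto simp: bounded_symbol_def norm_mult intro!: holomorphic_intros mult_mono)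

lemma bounded_symbol_add:
  "bounded_symbol f M \<Longrightarrow> bounded_symbol g N \<Longrightarrow> bounded_symbol (\<lambda>z. f z + g z) (M + N)"
  by (auto simp: bounded_symbol_def intro!: holomorphic_intros intro: norm_triangle_mono)

lemma bounded_symbol_const: "bounded_symbol (\<lambda>z. c) (cmod c)"
  by (auto simp: bounded_symbol_def)

text \<open>
Transposing twice reduces the composition of operators to associativity of convolution;
the double series itself need not converge absolutely.
\<close>

theorem backshift_mult:
  assumes f: "bounded_symbol f M" and g: "bounded_symbol g N" and x: "x \<in> l2"
  shows "backshift (\<lambda>z. f z * g z) x = backshift f (backshift g x)"
proof
  fix n
  have "backshift f (backshift g x) n = l2pair x (conv (coef g) (conv (coef f) (unit_seq n)))"
    unfolding backshift_def[of f] by (rule backshift_adjoint[OF g x conv_unit_seq_l2[OF f]])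
  also have "\<dots> = backshift (\<lambda>z. f z * g z) x n"
    using f g by (simp add: backshift_def bounded_symbol_def coef_mult conv_assoc[symmetric]
        conv_commute[of "coef g"])
  finally show "backshift (\<lambda>z. f z * g z) x n = backshift f (backshift g x) n" ..
qed

lemma backshift_linear:
  assumes f: "bounded_symbol f M" and x: "x \<in> l2" and y: "y \<in> l2"
  shows "backshift f (\<lambda>n. x n + y n) = (\<lambda>n. backshift f x n + backshift f y n)"
    and "backshift f (\<lambda>n. c * x n) = (\<lambda>n. c * backshift f x n)"
    and "backshift f (\<lambda>n. x n - y n) = (\<lambda>n. backshift f x n - backshift f y n)"
  using l2pair_summable[OF x conv_unit_seq_l2[OF f]] l2pair_summable[OF y conv_unit_seq_l2[OF f]]
  by (auto simp: backshift_def l2pair_def suminf_add suminf_mult suminf_diff summable_mult algebra_simps)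

lemma backshift_zero_seq: "backshift f (\<lambda>_. 0) = (\<lambda>_. 0)"
  by (simp add: backshift_def[abs_def] l2pair_def)

lemma backshift_add_symbol:
  assumes f: "bounded_symbol f M" and g: "bounded_symbol g N" and x: "x \<in> l2"
  shows "backshift (\<lambda>z. f z + g z) x n = backshift f x n + backshift g x n"
proof -
  have "conv (coef (\<lambda>z. f z + g z)) (unit_seq n) m
      = conv (coef f) (unit_seq n) m + conv (coef g) (unit_seq n) m" for m
    using f g by (simp add: conv_unit_seq coef_add bounded_symbol_def)
  then show ?thesis
    using l2pair_summable[OF x conv_unit_seq_l2[OF f]] l2pair_summable[OF x conv_unit_seq_l2[OF g]]
    by (simp add: backshift_def l2pair_def suminf_add[symmetric] algebra_simps)
qed

lemma backshift_const: "backshift (\<lambda>z. c) x n = c * x n"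
proof -
  have "conv (coef (\<lambda>z. c)) (unit_seq n) = (\<lambda>m. c * unit_seq n m)"
    by (auto simp: conv_unit_seq coef_const unit_seq_def)
  moreover have "(\<lambda>m. c * (x m * unit_seq n m)) sums (c * x n)"
    by (intro sums_mult unit_seq_sums)
  ultimately show ?thesis
    by (simp add: backshift_def l2pair_def sums_iff mult_ac)
qed

lemma backshift_id: "backshift (\<lambda>z. z) x n = x (Suc n)"
proof -
  have "conv (coef (\<lambda>z. z)) (unit_seq n) = unit_seq (Suc n)"
    by (rule ext) (auto simp: conv_unit_seq coef_id unit_seq_def)
  then show ?thesis
    by (simp add: backshift_def l2pair_unit_seq)
qed

lemma backshift_cmult_symbol:
  assumes f: "bounded_symbol f M" and x: "x \<in> l2"
  shows "backshift (\<lambda>z. c * f z) x n = c * backshift f x n"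
  using backshift_mult[OF bounded_symbol_const f x, of c] by (simp add: backshift_const)

lemma backshift_diff_symbol:
  assumes f: "bounded_symbol f M" and g: "bounded_symbol g N" and x: "x \<in> l2"
  shows "backshift (\<lambda>z. f z - g z) x n = backshift f x n - backshift g x n"
proof -
  have "bounded_symbol (\<lambda>z. - 1 * g z) (cmod (-1) * N)"
    by (rule bounded_symbol_mult[OF bounded_symbol_const g])
  from backshift_add_symbol[OF f this x, of n] show ?thesis
    using backshift_cmult_symbol[OF g x, of "-1" n] by simp
qed

lemma coef_cong:
  assumes "\<And>z. z \<in> ball 0 1 \<Longrightarrow> f z = g z"
  shows "coef f = coef g"
proof -
  have "fps_expansion f 0 = fps_expansion g 0"
    by (rule fps_expansion_cong)
       (use assms in \<open>auto intro!: eventually_nhds_in_open[of "ball 0 1", THEN eventually_mono]\<close>)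
  then show ?thesis
    by (simp add: coef_def fun_eq_iff)
qed

lemma backshift_cong:
  assumes "\<And>z. z \<in> ball 0 1 \<Longrightarrow> f z = g z"
  shows "backshift f = backshift g"
  using coef_cong[OF assms] by (simp add: backshift_def[abs_def])

lemma shifted_sums:
  assumes "(\<lambda>k. a k * y (k + n)) sums s"
  shows "(\<lambda>m. y m * conv a (unit_seq n) m) sums s"
proof -
  have "(\<lambda>k. y (k + n) * conv a (unit_seq n) (k + n)) sums s"
    using assms by (simp add: conv_unit_seq mult_ac)
  then show ?thesis
    by (subst (asm) sums_zero_iff_shift) (auto simp: conv_unit_seq)
qed

text \<open>
Geometric sequences are the eigenvectors of the backward shift.
\<close>

lemma backshift_geometric:
  assumes "f holomorphic_on ball 0 1" "cmod r < 1"
  shows "backshift f (\<lambda>n. r ^ n) n = f r * r ^ n"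
proof -
  have "(\<lambda>k. coef f k * r ^ (k + n)) sums (f r * r ^ n)"
    using sums_mult2[OF coef_sums[OF assms(1), of r], of "r ^ n"] assms(2)
    by (simp add: power_add mult_ac)
  from shifted_sums[OF this] show ?thesis
    by (simp add: backshift_def l2pair_def sums_iff)
qed

section \<open>The singular inner function and its model space\<close>

definition real_seq :: "(nat \<Rightarrow> complex) \<Rightarrow> bool" where
  "real_seq x \<longleftrightarrow> (\<forall>n. cnj (x n) = x n)"

lemma l2pair_self_real:
  assumes "x \<in> l2" "real_seq x"
  shows "l2pair x x = of_real ((l2norm x)\<^sup>2)"
proof -
  have "x n * x n = of_real ((cmod (x n))\<^sup>2)" for n
    using assms(2) by (metis complex_norm_square of_real_power real_seq_def)
  then show ?thesis
    using assms(1) by (simp add: l2pair_def l2norm_sq suminf_of_real l2_def del: of_real_power)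
qed

lemma l2pair_bilinear_square:
  assumes x: "x \<in> l2" and y: "y \<in> l2"
  shows "l2pair (\<lambda>n. x n + c * y n) (\<lambda>n. x n + c * y n)
    = l2pair x x + 2 * c * l2pair x y + c\<^sup>2 * l2pair y y"
proof -
  have "(\<lambda>n. x n * x n + 2 * c * (x n * y n) + c\<^sup>2 * (y n * y n)) sums
      (l2pair x x + 2 * c * l2pair x y + c\<^sup>2 * l2pair y y)"
    unfolding l2pair_def
    by (intro sums_add sums_mult summable_sums l2pair_summable x y)
  then show ?thesis
    by (simp add: l2pair_def sums_iff power2_eq_square algebra_simps)
qed

lemma real_seq_cnj_l2pair: "real_seq x \<Longrightarrow> real_seq y \<Longrightarrow> x \<in> l2 \<Longrightarrow> y \<in> l2 \<Longrightarrow> cnj (l2pair x y) = l2pair x y"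
  using sums_cnj[of "\<lambda>n. x n * y n" "l2pair x y"] summable_sums[OF l2pair_summable[of x y]]
  by (simp add: real_seq_def l2pair_def sums_iff)

lemma l2norm_conv_unit_seq:
  assumes "a \<in> l2"
  shows "l2norm (conv a (unit_seq n)) = l2norm a"
proof -
  have "(\<lambda>m. (cmod (conv a (unit_seq n) (m + n)))\<^sup>2) sums (\<Sum>k. (cmod (a k))\<^sup>2)"
    using assms by (simp add: conv_unit_seq l2_def summable_sums)
  then have "(\<lambda>m. (cmod (conv a (unit_seq n) m))\<^sup>2) sums (\<Sum>k. (cmod (a k))\<^sup>2)"
    by (subst (asm) sums_zero_iff_shift) (auto simp: conv_unit_seq)
  then show ?thesis
    by (simp add: l2norm_def sums_iff)
qed

lemma real_unit_seq: "real_seq (unit_seq n)"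
  by (simp add: real_seq_def unit_seq_def)

text \<open>
Each \<open>u\<^sub>i\<close>, the \<open>i\<close>-th shift of the coefficient sequence, has norm 1. For \<open>i \<noteq> j\<close> the vectors
\<open>u\<^sub>i \<plusminus> u\<^sub>j\<close> are images of vectors of squared norm 2 under a contraction, while their squared norms
are \<open>2 \<plusminus> 2p\<close> with \<open>p\<close> the inner product of \<open>u\<^sub>i\<close> and \<open>u\<^sub>j\<close>. Hence \<open>p = 0\<close>.
\<close>

lemma inner_symbol_orthonormal:
  assumes f: "bounded_symbol f 1" and re: "real_seq (coef f)" and norm: "l2norm (coef f) = 1"
  shows "l2pair (conv (coef f) (unit_seq i)) (conv (coef f) (unit_seq j)) = (if i = j then 1 else 0)"
proof -
  define u where "u i = conv (coef f) (unit_seq i)" for i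
  have u: "u i \<in> l2" for i
    unfolding u_def by (rule conv_unit_seq_l2[OF f])
  have ru: "real_seq (u i)" for i
    using re by (simp add: real_seq_def u_def conv_unit_seq)
  have uu: "l2pair (u i) (u i) = 1" for i
    using l2norm_conv_unit_seq[OF coef_l2[OF f], of i] norm
    by (simp add: l2pair_self_real[OF u ru]) (simp add: u_def)
  show ?thesis
  proof (cases "i = j")
    case True
    then show ?thesis using uu[of i] by (simp add: u_def)
  next
    case False
    define p where "p = Re (l2pair (u i) (u j))"
    have p: "l2pair (u i) (u j) = of_real p"
      using real_seq_cnj_l2pair[OF ru ru u u, of i j] unfolding p_def
      by (metis Reals_cnj_iff of_real_Re)
    have key: "2 + 2 * c * p \<le> 2" if c: "c\<^sup>2 = 1" for c :: real
    proof -
      let ?v = "\<lambda>n. u i n + of_real c * u j n"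
      let ?e = "\<lambda>n. unit_seq i n + of_real c * unit_seq j n"
      have v: "?v \<in> l2" "real_seq ?v"
        using l2_add(1)[OF u l2_scale(1)[OF u]] ru by (auto simp: real_seq_def)
      have e: "?e \<in> l2" "real_seq ?e"
        using l2_add(1)[OF unit_seq_l2 l2_scale(1)[OF unit_seq_l2]] real_unit_seq
        by (auto simp: real_seq_def)
      have cc: "(complex_of_real c)\<^sup>2 = 1"
        using c by (metis of_real_1 of_real_power)
      have "of_real ((l2norm ?v)\<^sup>2) = l2pair ?v ?v"
        by (simp add: l2pair_self_real[OF v])
      also have "\<dots> = of_real (2 + 2 * c * p)"
        by (simp add: l2pair_bilinear_square[OF u u] uu p cc)
      finally have v2: "(l2norm ?v)\<^sup>2 = 2 + 2 * c * p"
        by (simp only: of_real_eq_iff)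
      have "of_real ((l2norm ?e)\<^sup>2) = l2pair ?e ?e"
        by (simp add: l2pair_self_real[OF e])
      also have "\<dots> = of_real 2"
        using False
        by (simp add: l2pair_bilinear_square[OF unit_seq_l2 unit_seq_l2] l2pair_unit_seq cc)
           (simp add: unit_seq_def)
      finally have e2: "(l2norm ?e)\<^sup>2 = 2"
        by (simp only: of_real_eq_iff)
      have "conv (coef f) ?e = ?v"
        by (auto simp: u_def conv_def sum.distrib sum_distrib_left algebra_simps)
      then have "l2norm ?v \<le> l2norm ?e"
        using conv_bound(2)[OF f e(1)] by simp
      then have "(l2norm ?v)\<^sup>2 \<le> (l2norm ?e)\<^sup>2"
        by (intro power_mono l2norm_nonneg v)
      then show ?thesis
        using v2 e2 by simp
    qed
    from key[of 1] key[of "-1"] have "p = 0" by simp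
    then show ?thesis using False p by (simp add: u_def)
  qed
qed

text \<open>
For real coefficients the pairing with a coefficient sequence is an inner product, so the
transpose is the adjoint, and the orthonormality of the shifts of the coefficient
sequence says that multiplication by \<open>f\<close> is an isometry.
\<close>

theorem inner_symbol_isometry:
  assumes f: "bounded_symbol f 1" and re: "real_seq (coef f)" and norm: "l2norm (coef f) = 1"
    and y: "y \<in> l2"
  shows "backshift f (conv (coef f) y) = y"
proof
  fix n
  let ?u = "\<lambda>i. conv (coef f) (unit_seq i)"
  have sym: "l2pair a b = l2pair b a" for a b
    by (simp add: l2pair_def mult.commute)
  have "backshift f (conv (coef f) y) n = l2pair (?u n) (conv (coef f) y)"
    unfolding backshift_def by (rule sym)
  also have "\<dots> = l2pair (backshift f (?u n)) y"
    by (rule backshift_adjoint[symmetric, OF f conv_unit_seq_l2[OF f] y])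
  also have "backshift f (?u n) = unit_seq n"
    using inner_symbol_orthonormal[OF f re norm] by (auto simp: backshift_def unit_seq_def)
  finally show "backshift f (conv (coef f) y) n = y n"
    using sym[of "unit_seq n" y] by (simp add: l2pair_unit_seq)
qed

text \<open>
The singular inner function with unit mass at the boundary point 1.
\<close>

definition \<theta> :: "complex \<Rightarrow> complex" where
  "\<theta> z = exp (- ((1 + z) / (1 - z)))"

lemma Re_cayley: "Re ((1 + z) / (1 - z)) = (1 - (cmod z)\<^sup>2) / (cmod (1 - z))\<^sup>2"
  unfolding Re_divide cmod_power2 by (simp add: power2_eq_square algebra_simps)

text \<open>
The exponent is minus the Poisson kernel.
\<close>

lemma cmod_\<theta>: "cmod (\<theta> z) = exp (- ((1 - (cmod z)\<^sup>2) / (cmod (1 - z))\<^sup>2))"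
  unfolding \<theta>_def norm_exp_eq_Re uminus_complex.sel Re_cayley ..

lemma \<theta>_symbol: "bounded_symbol \<theta> 1"
  unfolding bounded_symbol_def
proof
  show "\<theta> holomorphic_on ball 0 1"
    unfolding \<theta>_def by (intro holomorphic_intros) auto
  show "\<forall>z\<in>ball 0 1. cmod (\<theta> z) \<le> 1"
    unfolding cmod_\<theta> by (auto simp: abs_square_le_1)
qed

text \<open>
The function commutes with complex conjugation, and Taylor coefficients are unique.
\<close>

lemma coef_\<theta>_real: "real_seq (coef \<theta>)"
proof -
  have hol: "\<theta> holomorphic_on ball 0 1"
    using \<theta>_symbol by (simp add: bounded_symbol_def)
  define y where "y n = cnj (coef \<theta> n)" for n
  have "y \<in> l2"
    unfolding y_def by (rule l2_cnj[OF coef_l2[OF \<theta>_symbol]])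
  then obtain Y where Y: "Y holomorphic_on ball 0 1" "coef Y = y"
    by (rule l2_generating_function)
  have "Y z = \<theta> z" if z: "z \<in> ball 0 1" for z
  proof -
    have "(\<lambda>k. coef \<theta> k * cnj z ^ k) sums \<theta> (cnj z)"
      by (rule coef_sums[OF hol]) (use z in simp)
    then have "(\<lambda>k. cnj (coef \<theta> k * cnj z ^ k)) sums cnj (\<theta> (cnj z))"
      by (simp only: sums_cnj)
    then have "(\<lambda>k. y k * z ^ k) sums \<theta> z"
      by (simp add: y_def \<theta>_def exp_cnj)
    moreover have "(\<lambda>k. y k * z ^ k) sums Y z"
      using coef_sums[OF Y(1) z] Y(2) by simp
    ultimately show ?thesis
      by (rule sums_unique2[symmetric])
  qed
  then have "coef Y = coef \<theta>"
    by (rule coef_cong)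
  then show ?thesis
    by (simp add: Y(2) real_seq_def y_def fun_eq_iff)
qed

text \<open>
The Poisson kernel tends to 0 at every point of the circle other than 1, so \<open>\<bar>\<theta>\<bar>\<close> has radial limit
1 almost everywhere, and dominated convergence gives mean square 1.
\<close>

lemma l2norm_coef_\<theta>: "l2norm (coef \<theta>) = 1"
proof (rule antisym)
  have hol: "\<theta> holomorphic_on ball 0 1"
    using \<theta>_symbol by (simp add: bounded_symbol_def)
  have l2: "coef \<theta> \<in> l2"
    by (rule coef_l2[OF \<theta>_symbol])
  have "l2norm (unit_seq 0) = 1"
    using l2pair_self_real[OF unit_seq_l2 real_unit_seq, of 0]
      l2norm_nonneg[OF unit_seq_l2, of 0]
    by (auto simp: l2pair_unit_seq unit_seq_def complex_eq_iff power2_eq_1_iff)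
  moreover have "conv (coef \<theta>) (unit_seq 0) = coef \<theta>"
    by (auto simp: conv_unit_seq)
  ultimately show "l2norm (coef \<theta>) \<le> 1"
    using conv_bound(2)[OF \<theta>_symbol unit_seq_l2, of 0] by simp
  define r where "r n = 1 - 1 / (real n + 1)" for n
  have r: "0 \<le> r n" "r n < 1" for n
    by (auto simp: r_def)
  have r1: "r \<longlonglongrightarrow> 1"
    unfolding r_def by real_asymp
  let ?g = "\<lambda>n t. (cmod (\<theta> (of_real (r n) * cis (2 * pi * t))))\<^sup>2"
  have "(\<lambda>n. integral {0<..<1} (?g n)) \<longlonglongrightarrow> integral {0<..<1} (\<lambda>t::real. 1)"
  proof (rule dominated_convergence(2))
    show "?g n integrable_on {0<..<1}" for n
      using integrable_on_circle[OF hol r] by (simp add: integrable_on_open_interval_real)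
    show "(\<lambda>t::real. 1::real) integrable_on {0<..<1}"
      by (simp add: integrable_on_open_interval_real integrable_const_ivl)
    show "norm (?g n t) \<le> 1" for n t
      using \<theta>_symbol circle_point_in_ball[OF r]
      by (auto simp: bounded_symbol_def intro!: power_le_one)
    show "(\<lambda>n. ?g n t) \<longlonglongrightarrow> 1" if t: "t \<in> {0<..<1}" for t
    proof -
      \<comment> \<open>on the open interval the denominator of the Poisson kernel stays away from 0\<close>
      have ne: "cis (2 * pi * t) \<noteq> 1"
      proof
        assume "cis (2 * pi * t) = 1"
        then obtain n :: int where "2 * pi * t = of_int (2 * n) * pi"
          by (auto simp: cis_conv_exp exp_eq_1)
        then have "t = of_int n" by simp
        with t show False by auto
      qed
      have "(\<lambda>n. (exp (- ((1 - (r n)\<^sup>2) / (cmod (1 - of_real (r n) * cis (2 * pi * t)))\<^sup>2)))\<^sup>2)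
          \<longlonglongrightarrow> (exp (- ((1 - 1\<^sup>2) / (cmod (1 - of_real 1 * cis (2 * pi * t)))\<^sup>2)))\<^sup>2"
        using ne by (intro tendsto_intros r1) auto
      then show ?thesis
        using r by (simp add: cmod_\<theta> norm_mult)
    qed
  qed
  then have "(\<lambda>n. integral {0..1} (?g n)) \<longlonglongrightarrow> 1"
    unfolding integral_open_interval_real[symmetric] by simp
  moreover have "integral {0..1} (?g n) \<le> (l2norm (coef \<theta>))\<^sup>2" for n
  proof -
    note par = parseval_circle[OF hol r[of n]]
    have "integral {0..1} (?g n) = (\<Sum>k. (cmod (coef \<theta> k * of_real (r n) ^ k))\<^sup>2)"
      using par by (simp add: sums_iff)
    also have "\<dots> \<le> (\<Sum>k. (cmod (coef \<theta> k))\<^sup>2)"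
    proof (intro suminf_le)
      show "summable (\<lambda>k. (cmod (coef \<theta> k * of_real (r n) ^ k))\<^sup>2)"
        using par by (simp add: sums_iff)
      show "summable (\<lambda>k. (cmod (coef \<theta> k))\<^sup>2)"
        using l2 by (simp add: l2_def)
      show "(cmod (coef \<theta> k * of_real (r n) ^ k))\<^sup>2 \<le> (cmod (coef \<theta> k))\<^sup>2" for k
        using r[of n] by (intro power_mono) (auto simp: norm_mult norm_power intro!: mult_right_le_one_le power_le_one)
    qed
    finally show ?thesis
      by (simp add: l2norm_sq[OF l2])
  qed
  ultimately have "1 \<le> (l2norm (coef \<theta>))\<^sup>2"
    by (intro LIMSEQ_le_const2) auto
  then show "1 \<le> l2norm (coef \<theta>)"
    using power2_le_imp_le[of 1 "l2norm (coef \<theta>)"] l2norm_nonneg[OF l2] by simp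
qed

text \<open>
The model space of \<open>\<theta>\<close>, realised as the kernel of \<open>\<theta>(L)\<close>. On it symbols count only modulo \<open>\<theta>\<close>.
\<close>

definition model :: "(nat \<Rightarrow> complex) set" where
  "model = {x \<in> l2. backshift \<theta> x = (\<lambda>_. 0)}"

lemma geometric_l2:
  assumes "0 \<le> r" "r < 1"
  shows "(\<lambda>n. complex_of_real r ^ n) \<in> l2"
proof -
  have "r ^ 2 < 1"
    using assms by (simp add: power_less_one_iff)
  then have "summable (\<lambda>n. (r ^ 2) ^ n)"
    using assms by (intro summable_geometric) simp
  then show ?thesis
    using assms by (simp add: l2_def norm_power power_mult[symmetric] mult.commute abs_of_nonneg)
qed

text \<open>
The geometric sequence \<open>y\<close> with ratio \<open>r\<close> is an eigenvector of \<open>f(L)\<close> with eigenvalue \<open>f(r)\<close>, but it is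
not in the kernel of \<open>\<theta>(L)\<close>. Since \<open>\<theta>(L)\<close> undoes multiplication by \<open>\<theta>\<close>, subtracting \<open>\<theta>(r)\<close> times
the product of \<open>\<theta>\<close> and \<open>y\<close> corrects this, and for small \<open>\<theta>(r)\<close> the correction is small relative
to \<open>y\<close>. The number \<open>N\<close> is the norm of \<open>y\<close>.
\<close>

lemma approximate_eigenvector:
  assumes r: "0 \<le> r" "r < 1" and f: "bounded_symbol f M"
  obtains x N where "x \<in> model" "N > 0" "(1 - cmod (\<theta> (of_real r))) * N \<le> l2norm x"
    "l2norm (backshift f x) \<le> (cmod (f (of_real r)) + cmod (\<theta> (of_real r)) * M) * N"
proof -
  define y where "y n = complex_of_real r ^ n" for n
  define q where "q = conv (coef \<theta>) y"
  define c where "c = \<theta> (of_real r)"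
  define x where "x n = y n - c * q n" for n
  have y: "y \<in> l2" unfolding y_def by (rule geometric_l2[OF r])
  have q: "q \<in> l2" "l2norm q \<le> l2norm y"
    using conv_bound[OF \<theta>_symbol y] by (simp_all add: q_def)
  note cq = l2_scale[OF q(1), of c]
  have xl2: "x \<in> l2" unfolding x_def by (rule l2_diff(1)[OF y cq(1)])
  have geo: "backshift g y = (\<lambda>n. g (of_real r) * y n)" if "bounded_symbol g K" for g K
    using that r backshift_geometric[of g "of_real r"]
    by (intro ext) (simp add: bounded_symbol_def y_def[abs_def])
  have backshift_x: "backshift g x = (\<lambda>n. g (of_real r) * y n - c * backshift g q n)" if "bounded_symbol g K" for g K
    unfolding x_def backshift_linear(3)[OF that y cq(1)] backshift_linear(2)[OF that q(1) q(1)] geo[OF that] ..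
  have "backshift \<theta> q = y"
    unfolding q_def by (rule inner_symbol_isometry[OF \<theta>_symbol coef_\<theta>_real l2norm_coef_\<theta> y])
  then have "x \<in> model"
    using xl2 by (simp add: model_def backshift_x[OF \<theta>_symbol] c_def)
  moreover have "l2norm y > 0"
    using cmod_le_l2norm[OF y, of 0] by (simp add: y_def)
  moreover have "(1 - cmod c) * l2norm y \<le> l2norm x"
  proof -
    have "l2norm y - cmod c * l2norm q \<le> l2norm x"
      using l2norm_reverse_triangle[OF y cq(1)] by (simp add: cq(2) x_def[abs_def])
    moreover have "cmod c * l2norm q \<le> cmod c * l2norm y"
      using q(2) by (intro mult_left_mono) auto
    ultimately show ?thesis by (simp add: left_diff_distrib)
  qed
  moreover have "l2norm (backshift f x) \<le> (cmod (f (of_real r)) + cmod c * M) * l2norm y"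
  proof -
    note fq = backshift_bound[OF f q(1)]
    have "l2norm (backshift f x) \<le> cmod (f (of_real r)) * l2norm y + cmod c * l2norm (backshift f q)"
      unfolding backshift_x[OF f]
      using l2_diff(2)[OF l2_scale(1)[OF y] l2_scale(1)[OF fq(1)]]
      by (simp add: l2_scale(2)[OF y] l2_scale(2)[OF fq(1)])
    also have "cmod c * l2norm (backshift f q) \<le> cmod c * (M * l2norm y)"
      by (intro mult_left_mono order_trans[OF fq(2)] q(2) bounded_symbol_nonneg[OF f]) auto
    finally show ?thesis by (simp add: algebra_simps)
  qed
  ultimately show ?thesis
    using that unfolding c_def by blast
qed

section \<open>An analytic function whose values form a cusp\<close>

text \<open>
The map \<open>\<psi>\<close> sends the unit disc into the half-strip \<open>Re w \<ge> 4\<close>, \<open>\<bar>Im w\<bar> \<le> 2\<close>. Therefore the values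
of \<open>\<phi> = 1 / \<psi>\<close> lie in a region with a cusp at 0, tangent to the positive real axis. The constant
5 only keeps the half-strip away from 0.
\<close>

definition \<psi> :: "complex \<Rightarrow> complex" where
  "\<psi> z = 5 - Ln (1 - z)"

definition \<phi> :: "complex \<Rightarrow> complex" where
  "\<phi> z = 1 / \<psi> z"

lemma Ln_disc:
  assumes "z \<in> ball 0 1"
  shows "Re (Ln (1 - z)) \<le> 1" "\<bar>Im (Ln (1 - z))\<bar> \<le> 2" "1 - z \<noteq> 0" "0 < Re (1 - z)"
proof -
  have "Re z < 1"
    using assms complex_Re_le_cmod[of z] by simp
  then show pos: "0 < Re (1 - z)" by simp
  then show ne: "1 - z \<noteq> 0" by auto
  have "\<bar>Im (Ln (1 - z))\<bar> < pi / 2"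
    by (rule Re_Ln_pos_lt_imp[OF pos])
  then show "\<bar>Im (Ln (1 - z))\<bar> \<le> 2"
    using pi_less_4 by linarith
  have "cmod (1 - z) \<le> 2"
    using assms norm_triangle_ineq4[of 1 z] by simp
  then have "ln (cmod (1 - z)) \<le> ln (exp 1)"
    using ne exp_ge_add_one_self[of 1] by (intro ln_mono) auto
  then show "Re (Ln (1 - z)) \<le> 1"
    using ne by simp
qed

lemma \<psi>_strip: "z \<in> ball 0 1 \<Longrightarrow> 4 \<le> Re (\<psi> z)" "z \<in> ball 0 1 \<Longrightarrow> \<bar>Im (\<psi> z)\<bar> \<le> 2"
  using Ln_disc[of z] by (simp_all add: \<psi>_def)

lemma \<psi>_ne_0: "z \<in> ball 0 1 \<Longrightarrow> \<psi> z \<noteq> 0"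
  using \<psi>_strip(1)[of z] by auto

lemma \<psi>_holomorphic: "\<psi> holomorphic_on ball 0 1"
  unfolding \<psi>_def
  by (intro holomorphic_intros) (use Ln_disc(4) complex_nonpos_Reals_iff in force)

lemma \<phi>_symbol: "bounded_symbol \<phi> 1"
  unfolding bounded_symbol_def
proof
  show "\<phi> holomorphic_on ball 0 1"
    unfolding \<phi>_def by (intro holomorphic_intros \<psi>_holomorphic) (use \<psi>_ne_0 in auto)
  show "\<forall>z\<in>ball 0 1. cmod (\<phi> z) \<le> 1"
  proof
    fix z :: complex assume z: "z \<in> ball 0 1"
    have "1 \<le> cmod (\<psi> z)"
      using \<psi>_strip(1)[OF z] complex_Re_le_cmod[of "\<psi> z"] by linarith
    then show "cmod (\<phi> z) \<le> 1"
      by (simp add: \<phi>_def norm_divide divide_le_eq)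
  qed
qed

text \<open>
In a horizontal strip the modulus differs little from the real part when the real part is
large, so that subtracting 1 lowers the modulus by almost 1.
\<close>

lemma cmod_minus_1_strip:
  assumes "1 < Re w" "\<bar>Im w\<bar> \<le> 2"
  shows "cmod (w - 1) \<le> cmod w - 1 + 2 / (Re w - 1)"
proof -
  define u where "u = Re w - 1"
  have u: "u > 0" using assms by (simp add: u_def)
  have "(Im w)\<^sup>2 \<le> 4"
    using assms(2) abs_le_square_iff[of "Im w" 2] by simp
  also have "u\<^sup>2 + 4 \<le> (u + 2 / u)\<^sup>2"
    using u by (simp add: power2_sum)
  finally have "u\<^sup>2 + (Im w)\<^sup>2 \<le> (u + 2 / u)\<^sup>2"
    by simp
  then have "cmod (w - 1) \<le> u + 2 / u"
    unfolding cmod_def using u by (intro real_le_lsqrt) (auto simp: u_def)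
  then show ?thesis
    using complex_Re_le_cmod[of w] by (simp add: u_def)
qed

lemma cmod_1_minus_\<phi>:
  assumes z: "z \<in> ball 0 1" and d: "2 / (Re (\<psi> z) - 1) \<le> d"
  shows "cmod (1 - \<phi> z) \<le> 1 - (1 - d) * cmod (\<phi> z)"
proof -
  have ne: "\<psi> z \<noteq> 0" by (rule \<psi>_ne_0[OF z])
  have "cmod (\<psi> z - 1) \<le> cmod (\<psi> z) - (1 - d)"
    using cmod_minus_1_strip[of "\<psi> z"] \<psi>_strip[OF z] d by simp
  then have "cmod (\<psi> z - 1) / cmod (\<psi> z) \<le> (cmod (\<psi> z) - (1 - d)) / cmod (\<psi> z)"
    by (rule divide_right_mono) simp
  moreover have "1 - \<phi> z = (\<psi> z - 1) / \<psi> z"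
    using ne by (simp add: \<phi>_def field_simps)
  ultimately show ?thesis
    using ne by (simp add: \<phi>_def norm_divide field_simps)
qed

lemma \<phi>_contraction:
  assumes z: "z \<in> ball 0 1"
  shows "cmod (1 - \<phi> z) \<le> 1 - cmod (\<phi> z) / 3"
proof -
  have "2 / (Re (\<psi> z) - 1) \<le> 2 / 3"
    using \<psi>_strip(1)[OF z] by (intro divide_left_mono) auto
  from cmod_1_minus_\<phi>[OF z this] show ?thesis by simp
qed

text \<open>
Near the cusp the values of \<open>\<phi>\<close> are almost positive: \<open>\<bar>1 - w\<bar>\<close> is there as small as it would be for a
positive number slightly smaller than \<open>\<bar>w\<bar>\<close>. A small value of \<open>\<phi>\<close> means a large modulus, hence
a large real part, of \<open>\<psi>\<close>.
\<close>

lemma \<phi>_cusp: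
  assumes "0 < d"
  obtains \<delta> where "\<delta> > 0"
    "\<And>z. z \<in> ball 0 1 \<Longrightarrow> cmod (\<phi> z) < \<delta> \<Longrightarrow> cmod (1 - \<phi> z) \<le> 1 - (1 - d) * cmod (\<phi> z)"
proof
  show "1 / (3 + 2 / d) > 0"
    using assms by (simp add: add_pos_pos)
  fix z :: complex
  assume z: "z \<in> ball 0 1" and small: "cmod (\<phi> z) < 1 / (3 + 2 / d)"
  have "3 + 2 / d < cmod (\<psi> z)"
    using small \<psi>_ne_0[OF z] assms by (simp add: \<phi>_def norm_divide field_simps)
  also have "\<dots> \<le> Re (\<psi> z) + 2"
    using cmod_le[of "\<psi> z"] \<psi>_strip[OF z] by linarith
  finally have "2 / d \<le> Re (\<psi> z) - 1" by simp
  then have "2 / (Re (\<psi> z) - 1) \<le> d"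
    using \<psi>_strip(1)[OF z] assms by (simp add: field_simps)
  then show "cmod (1 - \<phi> z) \<le> 1 - (1 - d) * cmod (\<phi> z)"
    by (rule cmod_1_minus_\<phi>[OF z])
qed

lemma mult_exp_minus_le: "x * exp (- x) \<le> 1 / exp (1::real)"
proof -
  have "x \<le> exp (x - 1)"
    using exp_ge_add_one_self[of "x - 1"] by simp
  then have "x * exp (- x) \<le> exp (x - 1) * exp (- x)"
    by (rule mult_right_mono) simp
  also have "\<dots> = 1 / exp 1"
    by (simp add: exp_diff exp_minus)
  finally show ?thesis .
qed

text \<open>
The quantity \<open>1 - \<bar>1 - w\<bar>\<close> controls both \<open>exp (- t w)\<close> and \<open>(1 - w) ^ n\<close>, so one estimate serves
the semigroup and the powers. For small \<open>w = \<phi> z\<close> it is at least \<open>b \<bar>w\<bar>\<close>, with \<open>b < 1\<close> as close to 1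
as desired, and \<open>x exp (- x)\<close> is at most \<open>1 / e\<close>; for the other \<open>w\<close> it is bounded below, and the
exponential decay beats the factor \<open>t\<close>.
\<close>

lemma \<phi>_decay:
  assumes C: "1 / exp 1 < C"
  shows "\<forall>\<^sub>F t in at_top. \<forall>z\<in>ball 0 1.
    t * (cmod (\<phi> z) * exp (- (t * (1 - cmod (1 - \<phi> z))))) \<le> C"
proof -
  \<comment> \<open>chosen so that losing the factor \<open>b\<close> raises the bound \<open>1 / e\<close> exactly to \<open>C\<close>\<close>
  define b where "b = 1 / (C * exp 1)"
  have C0: "C > 0"
    using C by (rule less_trans[rotated]) simp
  have b: "0 < b" "b < 1"
    using C C0 by (auto simp: b_def field_simps)
  obtain \<delta> where \<delta>: "\<delta> > 0"
    and cusp: "\<And>z. z \<in> ball 0 1 \<Longrightarrow> cmod (\<phi> z) < \<delta> \<Longrightarrow> cmod (1 - \<phi> z) \<le> 1 - b * cmod (\<phi> z)"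
    using \<phi>_cusp[of "1 - b"] b by auto
  have "((\<lambda>t. t * exp (- (t * (\<delta> / 3)))) \<longlongrightarrow> 0) at_top"
    using \<delta> by real_asymp
  then have "\<forall>\<^sub>F t in at_top. t * exp (- (t * (\<delta> / 3))) < C"
    using C0 by (rule order_tendstoD)
  then show ?thesis
    using eventually_ge_at_top[of 0]
  proof eventually_elim
    case (elim t)
    show ?case
    proof
      fix z :: complex assume z: "z \<in> ball 0 1"
      define r where "r = cmod (\<phi> z)"
      have r: "0 \<le> r" "r \<le> 1"
        using \<phi>_symbol z by (auto simp: r_def bounded_symbol_def)
      show "t * (cmod (\<phi> z) * exp (- (t * (1 - cmod (1 - \<phi> z))))) \<le> C"
      proof (cases "r < \<delta>")
        case True
        have "t * (r * exp (- (t * (1 - cmod (1 - \<phi> z))))) \<le> t * (r * exp (- (t * (b * r))))"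
          using cusp[OF z] True r elim unfolding r_def[symmetric]
          by (intro mult_left_mono) (auto intro!: mult_left_mono)
        also have "\<dots> = ((t * (b * r)) * exp (- (t * (b * r)))) / b"
          using b by simp
        also have "\<dots> \<le> (1 / exp 1) / b"
          by (intro divide_right_mono mult_exp_minus_le) (use b in simp)
        also have "\<dots> = C"
          using C0 by (simp add: b_def)
        finally show ?thesis by (simp add: r_def)
      next
        case False
        have "\<delta> / 3 \<le> 1 - cmod (1 - \<phi> z)"
          using \<phi>_contraction[OF z] False by (simp add: r_def)
        then have "t * (\<delta> / 3) \<le> t * (1 - cmod (1 - \<phi> z))"
          using elim by (intro mult_left_mono) auto
        then have "t * (r * exp (- (t * (1 - cmod (1 - \<phi> z))))) \<le> t * (1 * exp (- (t * (\<delta> / 3))))"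
          using r elim by (intro mult_left_mono mult_mono) auto
        then show ?thesis
          using elim by (simp add: r_def)
      qed
    qed
  qed
qed

lemma exp_symbol_decay:
  assumes "0 \<le> t"
  shows "cmod (exp (of_real (- t) * w)) \<le> exp (- (t * (1 - cmod (1 - w))))"
proof -
  have "1 - cmod (1 - w) \<le> Re w"
    using complex_Re_le_cmod[of "1 - w"] by simp
  then show ?thesis
    using assms by (simp add: mult_left_mono)
qed

lemma power_symbol_decay:
  shows "cmod ((1 - w) ^ n) \<le> exp (- (real n * (1 - cmod (1 - w))))"
proof -
  have "cmod (1 - w) \<le> exp (- (1 - cmod (1 - w)))"
    using exp_ge_add_one_self[of "- (1 - cmod (1 - w))"] by simp
  then have "cmod (1 - w) ^ n \<le> exp (- (1 - cmod (1 - w))) ^ n"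
    by (rule power_mono) simp
  also have "\<dots> = exp (- (real n * (1 - cmod (1 - w))))"
    by (simp add: exp_of_nat_mult[symmetric] algebra_simps)
  finally show ?thesis by (simp add: norm_power)
qed

section \<open>Inverses modulo the inner function\<close>

text \<open>
As a function of \<open>s = Ln (1 - z)\<close>, the function \<open>\<theta>\<close> extends to an entire function without zeros.
\<close>

lemma \<theta>_Ln:
  assumes "z \<in> ball 0 1"
  shows "\<theta> z = exp (1 - 2 * exp (- Ln (1 - z)))"
proof -
  have ne: "1 - z \<noteq> 0" by (rule Ln_disc(3)[OF assms])
  then have "exp (- Ln (1 - z)) = 1 / (1 - z)"
    by (simp add: exp_minus inverse_eq_divide)
  moreover have "- ((1 + z) / (1 - z)) = 1 - 2 * (1 / (1 - z))"
    using ne by (simp add: divide_simps)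
  ultimately show ?thesis
    by (simp only: \<theta>_def)
qed

text \<open>
This says that \<open>w - \<phi>\<close> is invertible modulo \<open>\<theta>\<close> for every \<open>w \<noteq> 0\<close>. In the variable \<open>s = Ln (1 - z)\<close>
the equation \<open>\<phi> = w\<close> has the single root \<open>\<mu> = 5 - 1 / w\<close>, whether or not \<open>\<mu>\<close> corresponds to a point
of the disc. The entire function \<open>F = 1 - \<Theta> / \<Theta>(\<mu>)\<close> vanishes at \<open>\<mu>\<close>, so \<open>F\<close> can be divided by
\<open>s - \<mu>\<close>. The quotient decays like \<open>1 / \<bar>s - \<mu>\<bar>\<close> on the image of the disc, which compensates the
growth of \<open>\<psi>\<close>.
\<close>

theorem resolvent_symbol:
  assumes w: "w \<noteq> 0"
  obtains u M c where "bounded_symbol u M"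
    "\<And>z. z \<in> ball 0 1 \<Longrightarrow> u z * (w - \<phi> z) = 1 - c * \<theta> z"
proof -
  define \<mu> where "\<mu> = 5 - 1 / w"
  define \<Theta> where "\<Theta> s = exp (1 - 2 * exp (- s))" for s :: complex
  define F where "F s = 1 - \<Theta> s / \<Theta> \<mu>" for s
  \<comment> \<open>the quotient of \<open>F\<close> by \<open>s - \<mu>\<close>, with its removable singularity filled in\<close>
  define G where "G s = (if s = \<mu> then deriv F \<mu> else (F s - F \<mu>) / (s - \<mu>))" for s
  define u where "u z = - (\<psi> z * G (Ln (1 - z)) / w)" for z
  have "\<Theta> \<mu> \<noteq> 0" by (simp add: \<Theta>_def)
  then have F\<mu>: "F \<mu> = 0" by (simp add: F_def)
  have "F holomorphic_on UNIV"
    unfolding F_def \<Theta>_def by (intro holomorphic_intros) auto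
  then have G: "G holomorphic_on UNIV"
    unfolding G_def by (rule pole_lemma_open) simp
  have GF: "G s * (s - \<mu>) = F s" for s
    by (simp add: G_def F\<mu>)
  have "compact (G ` cball \<mu> 1)"
    by (intro compact_continuous_image holomorphic_on_imp_continuous_on holomorphic_on_subset[OF G]) auto
  then obtain B where B: "0 < B" "\<And>s. s \<in> cball \<mu> 1 \<Longrightarrow> cmod (G s) \<le> B"
    using compact_imp_bounded bounded_pos by (metis imageI)
  define D where "D = 1 + 1 / cmod (\<Theta> \<mu>)"
  have D: "D \<ge> 0" by (simp add: D_def)
  have bound: "cmod (\<psi> z * G (Ln (1 - z))) \<le> (cmod (5 - \<mu>) + 1) * (B + D)" if z: "z \<in> ball 0 1" for z
  proof -
    define s where "s = Ln (1 - z)"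
    have \<psi>: "cmod (\<psi> z) \<le> cmod (5 - \<mu>) + cmod (s - \<mu>)"
      using norm_triangle_ineq4[of "5 - \<mu>" "s - \<mu>"] by (simp add: \<psi>_def s_def)
    have "\<Theta> s = \<theta> z"
      by (simp add: \<Theta>_def s_def \<theta>_Ln[OF z])
    then have "cmod (\<Theta> s) \<le> 1"
      using \<theta>_symbol z by (simp add: bounded_symbol_def)
    then have F: "cmod (F s) \<le> D"
      unfolding F_def D_def
      by (intro order_trans[OF norm_triangle_ineq4]) (simp add: norm_divide divide_right_mono)
    show ?thesis
    proof (cases "cmod (s - \<mu>) \<le> 1")
      case True
      then have "cmod (G s) \<le> B + D"
        using B(2)[of s] D by (simp add: dist_norm norm_minus_commute)
      then show ?thesis
        unfolding s_def[symmetric] norm_mult using \<psi> True by (intro mult_mono) auto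
    next
      case False
      then have eq: "cmod (G s) = cmod (F s) / cmod (s - \<mu>)"
        by (subst GF[of s, symmetric]) (auto simp: norm_mult)
      have "cmod (\<psi> z) / cmod (s - \<mu>) \<le> cmod (5 - \<mu>) + 1"
      proof -
        have "cmod (5 - \<mu>) * 1 \<le> cmod (5 - \<mu>) * cmod (s - \<mu>)"
          using False by (intro mult_left_mono) auto
        with \<psi> have "cmod (\<psi> z) \<le> (cmod (5 - \<mu>) + 1) * cmod (s - \<mu>)"
          by (simp add: distrib_right)
        then show ?thesis using False by (subst pos_divide_le_eq) auto
      qed
      then have "cmod (\<psi> z) / cmod (s - \<mu>) * cmod (F s) \<le> (cmod (5 - \<mu>) + 1) * (B + D)"
        using F B(1) by (intro mult_mono) auto
      then show ?thesis
        unfolding s_def[symmetric] norm_mult eq by simp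
    qed
  qed
  have "bounded_symbol u ((cmod (5 - \<mu>) + 1) * (B + D) / cmod w)"
    unfolding bounded_symbol_def
  proof (intro conjI ballI)
    have "(\<lambda>z. G (Ln (1 - z))) holomorphic_on ball 0 1"
    proof (rule holomorphic_on_compose_gen[OF _ G, unfolded o_def])
      show "(\<lambda>z. Ln (1 - z)) holomorphic_on ball 0 1"
        by (intro holomorphic_intros) (use Ln_disc(4) complex_nonpos_Reals_iff in force)
    qed auto
    then show "u holomorphic_on ball 0 1"
      unfolding u_def by (intro holomorphic_intros \<psi>_holomorphic) (use w in auto)
    show "cmod (u z) \<le> (cmod (5 - \<mu>) + 1) * (B + D) / cmod w" if "z \<in> ball 0 1" for z
      using bound[OF that] by (simp add: u_def norm_divide divide_right_mono)
  qed
  moreover have "u z * (w - \<phi> z) = 1 - (1 / \<Theta> \<mu>) * \<theta> z" if z: "z \<in> ball 0 1" for z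
  proof -
    define s where "s = Ln (1 - z)"
    have "u z * (w - \<phi> z) = - (G s * (\<psi> z * (w - \<phi> z) / w))"
      by (simp add: u_def s_def)
    also have "\<psi> z * (w - \<phi> z) / w = \<mu> - s"
      using \<psi>_ne_0[OF z] w by (simp add: \<phi>_def right_diff_distrib diff_divide_distrib)
        (simp add: \<psi>_def s_def \<mu>_def)
    also have "- (G s * (\<mu> - s)) = F s"
      using GF[of s] by (simp add: algebra_simps)
    also have "\<dots> = 1 - (1 / \<Theta> \<mu>) * \<theta> z"
      by (simp add: F_def \<Theta>_def s_def \<theta>_Ln[OF z])
    finally show ?thesis .
  qed
  ultimately show ?thesis by (rule that)
qed

text \<open>
Although \<open>\<psi> = 1 / \<phi>\<close> is unbounded, its growth is only logarithmic at 1, and the zero of \<open>1 - z\<close>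
absorbs it.
\<close>

lemma one_minus_symbol_factor:
  obtains g M where "bounded_symbol g M" "\<And>z. z \<in> ball 0 1 \<Longrightarrow> g z * \<phi> z = 1 - z"
proof
  show "bounded_symbol (\<lambda>z. (1 - z) * \<psi> z) 24"
    unfolding bounded_symbol_def
  proof (intro conjI ballI)
    show "(\<lambda>z. (1 - z) * \<psi> z) holomorphic_on ball 0 1"
      by (intro holomorphic_intros \<psi>_holomorphic)
    fix z :: complex assume z: "z \<in> ball 0 1"
    define \<rho> where "\<rho> = Re (Ln (1 - z))"
    have \<rho>: "\<rho> \<le> 1" and im: "\<bar>Im (Ln (1 - z))\<bar> \<le> 2"
      using Ln_disc[OF z] by (simp_all add: \<rho>_def)
    have e: "exp \<rho> \<le> 3"
      using \<rho> exp_le by (meson exp_le_cancel_iff order_trans)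
    have "cmod (1 - z) = exp \<rho>"
      using Ln_disc(3)[OF z] by (simp add: \<rho>_def)
    moreover have "cmod (\<psi> z) \<le> 7 + \<bar>\<rho>\<bar>"
    proof -
      have "cmod (\<psi> z) \<le> cmod 5 + cmod (Ln (1 - z))"
        unfolding \<psi>_def by (rule norm_triangle_ineq4)
      then show ?thesis
        using cmod_le[of "Ln (1 - z)"] im by (simp add: \<rho>_def)
    qed
    ultimately have "cmod ((1 - z) * \<psi> z) \<le> exp \<rho> * (7 + \<bar>\<rho>\<bar>)"
      by (simp add: norm_mult)
    also have "\<dots> \<le> 24"
    proof (cases "0 \<le> \<rho>")
      case True
      then have "exp \<rho> * (7 + \<bar>\<rho>\<bar>) \<le> 3 * 8"
        using e \<rho> by (intro mult_mono) auto
      then show ?thesis by simp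
    next
      case False
      have "- \<rho> * exp \<rho> \<le> 1 / exp 1"
        using mult_exp_minus_le[of "- \<rho>"] by simp
      also have "\<dots> \<le> 1" by simp
      finally have "- \<rho> * exp \<rho> \<le> 1" .
      then show ?thesis
        using False e by (simp add: algebra_simps)
    qed
    finally show "cmod ((1 - z) * \<psi> z) \<le> 24" .
  qed
  show "(1 - z) * \<psi> z * \<phi> z = 1 - z" if "z \<in> ball 0 1" for z
    using \<psi>_ne_0[OF that] by (simp add: \<phi>_def)
qed

text \<open>
If \<open>\<phi>(L)\<close> kills \<open>x\<close> then so does \<open>1 - L\<close>, a multiple of \<open>\<phi>(L)\<close>. Hence \<open>x\<close> is constant, and the only
square-summable constant is 0.
\<close>

lemma backshift_\<phi>_injective:
  assumes x: "x \<in> l2" and zero: "backshift \<phi> x = (\<lambda>_. 0)"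
  shows "x = (\<lambda>_. 0)"
proof -
  obtain g M where g: "bounded_symbol g M" and eq: "\<And>z. z \<in> ball 0 1 \<Longrightarrow> g z * \<phi> z = 1 - z"
    using one_minus_symbol_factor by blast
  have id: "bounded_symbol (\<lambda>z. (-1) * z) 1"
    by (auto simp: bounded_symbol_def intro!: holomorphic_intros)
  have idz: "bounded_symbol (\<lambda>z. z) 1"
    by (auto simp: bounded_symbol_def)
  have "backshift (\<lambda>z. 1 - z) x = backshift (\<lambda>z. g z * \<phi> z) x"
    using backshift_cong[OF eq] by simp
  also have "\<dots> = backshift g (backshift \<phi> x)"
    by (rule backshift_mult[OF g \<phi>_symbol x])
  also have "\<dots> = (\<lambda>_. 0)"
    by (simp add: zero backshift_zero_seq)
  finally have z0: "backshift (\<lambda>z. 1 + (-1) * z) x n = 0" for n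
    by simp
  have step: "x (Suc n) = x n" for n
    using z0[of n] backshift_add_symbol[OF bounded_symbol_const[of 1] id x, of n]
      backshift_cmult_symbol[OF idz x, of "-1" n]
    by (simp add: backshift_const backshift_id)
  have const: "x n = x 0" for n
    by (induction n) (simp_all add: step)
  have "summable (\<lambda>n::nat. (cmod (x 0))\<^sup>2)"
  proof -
    have "(\<lambda>n. (cmod (x n))\<^sup>2) = (\<lambda>n. (cmod (x 0))\<^sup>2)"
      using const by (intro ext) metis
    then show ?thesis
      using x by (simp add: l2_def)
  qed
  then have "x 0 = 0"
    by (simp add: summable_const_iff)
  with const show ?thesis by (intro ext) simp
qed

text \<open>
Both \<open>\<phi>(r)\<close> and \<open>\<theta>(r)\<close> tend to 0 as \<open>r\<close> tends to 1. So \<open>\<phi>(L)\<close> is not bounded below on the model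
space; in particular the model space is not zero.
\<close>

lemma approximate_kernel:
  assumes "0 < \<delta>"
  obtains x where "x \<in> model" "0 < l2norm x" "l2norm (backshift \<phi> x) \<le> \<delta> * l2norm x"
proof -
  have lim: "((\<lambda>t::real. 1 / (5 + t)) \<longlongrightarrow> 0) at_top" "((\<lambda>t::real. exp (1 - 2 * exp t)) \<longlongrightarrow> 0) at_top"
    by real_asymp+
  have "\<forall>\<^sub>F t::real in at_top. 1 / (5 + t) < \<delta> / 4"
    by (rule order_tendstoD(2)[OF lim(1)]) (use assms in simp)
  moreover have "\<forall>\<^sub>F t::real in at_top. exp (1 - 2 * exp t) < min (1 / 2) (\<delta> / 4)"
    by (rule order_tendstoD(2)[OF lim(2)]) (use assms in simp)
  ultimately have "\<forall>\<^sub>F t::real in at_top. 0 \<le> t \<and> 1 / (5 + t) < \<delta> / 4 \<and> exp (1 - 2 * exp t) < min (1 / 2) (\<delta> / 4)"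
    using eventually_ge_at_top[of 0] by eventually_elim simp
  then obtain t :: real where t: "0 \<le> t" "1 / (5 + t) < \<delta> / 4" "exp (1 - 2 * exp t) < min (1 / 2) (\<delta> / 4)"
    using eventually_happens by (metis (mono_tags, lifting) trivial_limit_at_top_linorder)
  \<comment> \<open>with this choice \<open>\<phi>(r) = 1 / (5 + t)\<close> and \<open>\<theta>(r) = exp (1 - 2 exp t)\<close>\<close>
  define r where "r = 1 - exp (- t)"
  have r: "0 \<le> r" "r < 1"
    using t by (auto simp: r_def)
  have Ln: "Ln (1 - of_real r) = of_real (- t)"
    using Ln_of_real[of "exp (- t)"] by (simp add: r_def del: Ln_exp)
  have "\<phi> (of_real r) = of_real (1 / (5 + t))"
    by (simp add: \<phi>_def \<psi>_def Ln)
  then have \<phi>r: "cmod (\<phi> (of_real r)) < \<delta> / 4"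
    using t by (simp only: norm_of_real) simp
  have "\<theta> (of_real r) = exp (1 - 2 * exp (- Ln (1 - of_real r)))"
    by (rule \<theta>_Ln) (use r in simp)
  also have "\<dots> = of_real (exp (1 - 2 * exp t))"
    unfolding Ln by (simp add: exp_of_real[symmetric])
  finally have \<theta>r: "cmod (\<theta> (of_real r)) < 1 / 2" "cmod (\<theta> (of_real r)) < \<delta> / 4"
    using t by (simp_all only: norm_of_real) auto
  obtain x N where x: "x \<in> model" "N > 0" "(1 - cmod (\<theta> (of_real r))) * N \<le> l2norm x"
    "l2norm (backshift \<phi> x) \<le> (cmod (\<phi> (of_real r)) + cmod (\<theta> (of_real r)) * 1) * N"
    by (rule approximate_eigenvector[OF r \<phi>_symbol])
  have "(1 / 2) * N \<le> (1 - cmod (\<theta> (of_real r))) * N"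
    using \<theta>r x(2) by (intro mult_right_mono) auto
  with x(3) have N: "N / 2 \<le> l2norm x" by simp
  have "l2norm (backshift \<phi> x) \<le> (\<delta> / 2) * N"
    using \<phi>r \<theta>r x(2) by (intro order_trans[OF x(4)] mult_right_mono) auto
  also have "\<dots> = \<delta> * (N / 2)" by simp
  also have "\<dots> \<le> \<delta> * l2norm x"
    using N assms by (intro mult_left_mono) auto
  finally show ?thesis
    using that x(1,2) N by simp
qed

section \<open>The model space as a Hilbert space\<close>

text \<open>
Sequences are stored as functions on the reals supported on the natural numbers.
\<close>

definition enc :: "(nat \<Rightarrow> complex) \<Rightarrow> real \<Rightarrow> complex" where
  "enc x t = (if t \<in> \<nat> then x (nat \<lfloor>t\<rfloor>) else 0)"

definition dec :: "(real \<Rightarrow> complex) \<Rightarrow> nat \<Rightarrow> complex" where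
  "dec y n = y (real n)"

definition model_space :: "(real \<Rightarrow> complex) inner_space" where
  "model_space = \<lparr>hcarrier = enc ` model, hzero = (\<lambda>_. 0),
     hadd = (\<lambda>x y t. x t + y t), hscale = (\<lambda>c x t. c * x t),
     hinner = (\<lambda>x y. l2pair (dec x) (\<lambda>n. cnj (dec y n)))\<rparr>"

definition symbol_op :: "(complex \<Rightarrow> complex) \<Rightarrow> (real \<Rightarrow> complex) \<Rightarrow> real \<Rightarrow> complex" where
  "symbol_op f x = enc (backshift f (dec x))"

lemma dec_enc: "dec (enc x) = x"
  by (auto simp: dec_def enc_def)

lemma symbol_op_enc: "symbol_op f (enc x) = enc (backshift f x)"
  by (simp add: symbol_op_def dec_enc)

lemma enc_eq_iff: "enc x = enc y \<longleftrightarrow> x = y"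
  by (metis dec_enc)

lemma enc_ops:
  "(\<lambda>_. 0) = enc (\<lambda>_. 0)"
  "(\<lambda>t. enc x t + enc y t) = enc (\<lambda>n. x n + y n)"
  "(\<lambda>t. c * enc x t) = enc (\<lambda>n. c * x n)"
  by (auto simp: enc_def)

lemma model_l2: "x \<in> model \<Longrightarrow> x \<in> l2"
  by (simp add: model_def)

lemma model_zero: "(\<lambda>_. 0) \<in> model"
  by (simp add: model_def l2_zero backshift_zero_seq)

lemma model_add: "x \<in> model \<Longrightarrow> y \<in> model \<Longrightarrow> (\<lambda>n. x n + y n) \<in> model"
  by (simp add: model_def l2_add backshift_linear[OF \<theta>_symbol])

lemma model_diff: "x \<in> model \<Longrightarrow> y \<in> model \<Longrightarrow> (\<lambda>n. x n - y n) \<in> model"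
  by (simp add: model_def l2_diff backshift_linear[OF \<theta>_symbol])

lemma model_scale: "x \<in> model \<Longrightarrow> (\<lambda>n. c * x n) \<in> model"
  by (simp add: model_def l2_scale backshift_linear(2)[OF \<theta>_symbol, of x x])

text \<open>
Symbols commute, so every \<open>f(L)\<close> preserves the kernel of \<open>\<theta>(L)\<close>.
\<close>

lemma model_backshift:
  assumes f: "bounded_symbol f M" and x: "x \<in> model"
  shows "backshift f x \<in> model"
proof -
  have "backshift \<theta> (backshift f x) = backshift f (backshift \<theta> x)"
    using backshift_mult[OF \<theta>_symbol f model_l2[OF x]] backshift_mult[OF f \<theta>_symbol model_l2[OF x]]
    by (simp add: mult.commute)
  then show ?thesis
    using x backshift_bound(1)[OF f model_l2[OF x]] by (simp add: model_def backshift_zero_seq)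
qed

text \<open>
The kernel of a bounded operator is closed.
\<close>

lemma model_closed:
  assumes X: "\<And>n. X n \<in> model" and x: "x \<in> l2"
    and lim: "(\<lambda>n. l2norm (\<lambda>k. X n k - x k)) \<longlonglongrightarrow> 0"
  shows "x \<in> model"
proof -
  note cx = backshift_bound(1)[OF \<theta>_symbol x]
  have "l2norm (backshift \<theta> x) \<le> l2norm (\<lambda>k. X n k - x k)" for n
  proof -
    have "backshift \<theta> (\<lambda>k. x k - X n k) = backshift \<theta> x"
      using X[of n] x by (simp add: model_def backshift_linear[OF \<theta>_symbol])
    then show ?thesis
      using backshift_bound(2)[OF \<theta>_symbol l2_diff(1)[OF x model_l2[OF X]], of n]
      by (simp add: l2norm_diff_commute[of x])
  qed
  then have "l2norm (backshift \<theta> x) \<le> 0"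
    by (intro LIMSEQ_le_const[OF lim]) auto
  then have "backshift \<theta> x = (\<lambda>_. 0)"
    using l2norm_nonneg[OF cx] by (intro l2norm_eq_0 cx) simp
  with x show ?thesis by (simp add: model_def)
qed

lemma carrier_model: "hcarrier model_space = enc ` model"
  by (simp add: model_space_def)

lemma zero_model: "hzero model_space = enc (\<lambda>_. 0)"
  by (simp add: model_space_def enc_ops(1))

lemma add_model: "hadd model_space (enc x) (enc y) = enc (\<lambda>n. x n + y n)"
  by (simp add: model_space_def enc_ops)

lemma scale_model: "hscale model_space c (enc x) = enc (\<lambda>n. c * x n)"
  by (simp add: model_space_def enc_ops)

lemma diff_model: "hdiff model_space (enc x) (enc y) = enc (\<lambda>n. x n - y n)"
  by (simp add: hdiff_def add_model scale_model)

lemma inner_model: "hinner model_space (enc x) (enc y) = l2pair x (\<lambda>n. cnj (y n))"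
  by (simp add: model_space_def dec_enc)

lemma inner_self_model: "x \<in> l2 \<Longrightarrow> hinner model_space (enc x) (enc x) = of_real ((l2norm x)\<^sup>2)"
  unfolding inner_model l2pair_def complex_norm_square[symmetric]
  by (simp add: l2norm_sq l2_def suminf_of_real del: of_real_power)

lemma norm_enc_l2: "x \<in> l2 \<Longrightarrow> hnorm model_space (enc x) = l2norm x"
  by (simp add: hnorm_def inner_self_model l2norm_nonneg)

lemma norm_enc: "x \<in> model \<Longrightarrow> hnorm model_space (enc x) = l2norm x"
  by (rule norm_enc_l2[OF model_l2])

theorem hilbert_model: "complex_hilbert_space model_space"
proof
  fix x y z :: "real \<Rightarrow> complex" and c d :: complex
  show "hzero model_space \<in> hcarrier model_space"
    by (auto simp: carrier_model zero_model model_zero)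
  assume "x \<in> hcarrier model_space"
  then obtain x' where x: "x = enc x'" "x' \<in> model"
    by (auto simp: carrier_model)
  note x'l2 = model_l2[OF x(2)]
  show "hscale model_space c x \<in> hcarrier model_space"
    using x by (auto simp: carrier_model scale_model model_scale)
  show "hadd model_space x (hzero model_space) = x"
    by (simp add: x zero_model add_model)
  show "hadd model_space x (hscale model_space (- 1) x) = hzero model_space"
    by (simp add: x zero_model add_model scale_model)
  show "hscale model_space (c + d) x = hadd model_space (hscale model_space c x) (hscale model_space d x)"
    by (simp add: x add_model scale_model algebra_simps)
  show "hscale model_space c (hscale model_space d x) = hscale model_space (c * d) x"
    by (simp add: x scale_model algebra_simps)
  show "hscale model_space 1 x = x"
    by (simp add: x scale_model)
  show "0 < Re (hinner model_space x x)" if "x \<noteq> hzero model_space"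
  proof -
    have "l2norm x' \<noteq> 0"
      using that l2norm_eq_0[OF x'l2] by (auto simp: x zero_model)
    then show ?thesis
      by (simp add: x inner_self_model[OF x'l2])
  qed
  assume "y \<in> hcarrier model_space"
  then obtain y' where y: "y = enc y'" "y' \<in> model"
    by (auto simp: carrier_model)
  note y'l2 = model_l2[OF y(2)]
  show "hadd model_space x y \<in> hcarrier model_space"
    using x y by (auto simp: carrier_model add_model model_add)
  show "hadd model_space x y = hadd model_space y x"
    by (simp add: x y add_model algebra_simps)
  show "hscale model_space c (hadd model_space x y) = hadd model_space (hscale model_space c x) (hscale model_space c y)"
    by (simp add: x y add_model scale_model algebra_simps)
  show "hinner model_space (hscale model_space c x) y = c * hinner model_space x y"
    using suminf_mult[OF l2pair_summable[OF x'l2 l2_cnj[OF y'l2]], of c]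
    by (simp add: x y scale_model inner_model l2pair_def mult_ac)
  show "hinner model_space x y = cnj (hinner model_space y x)"
    using sums_cnj[THEN iffD2, OF summable_sums[OF l2pair_summable[OF y'l2 l2_cnj[OF x'l2]]]]
    by (simp add: x y inner_model l2pair_def sums_iff mult_ac)
  assume "z \<in> hcarrier model_space"
  then obtain z' where z: "z = enc z'" "z' \<in> model"
    by (auto simp: carrier_model)
  note z'l2 = model_l2[OF z(2)]
  show "hadd model_space (hadd model_space x y) z = hadd model_space x (hadd model_space y z)"
    by (simp add: x y z add_model algebra_simps)
  show "hinner model_space (hadd model_space x y) z = hinner model_space x z + hinner model_space y z"
    using suminf_add[OF l2pair_summable[OF x'l2 l2_cnj[OF z'l2]] l2pair_summable[OF y'l2 l2_cnj[OF z'l2]]]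
    by (simp add: x y z add_model inner_model l2pair_def algebra_simps)
next
  fix X :: "nat \<Rightarrow> real \<Rightarrow> complex"
  assume X: "\<And>n. X n \<in> hcarrier model_space"
    and cauchy: "\<And>e. e > 0 \<Longrightarrow> \<exists>N. \<forall>m\<ge>N. \<forall>n\<ge>N. hnorm model_space (hdiff model_space (X m) (X n)) < e"
  obtain Y where Y: "\<And>n. X n = enc (Y n)" "\<And>n. Y n \<in> model"
  proof -
    have "\<forall>n. \<exists>y\<in>model. X n = enc y"
      using X by (auto simp: carrier_model)
    then obtain Y where "\<forall>n. Y n \<in> model \<and> X n = enc (Y n)"
      unfolding Bex_def by (rule choice[THEN exE])
    then show ?thesis using that by blast
  qed
  have norm: "hnorm model_space (hdiff model_space (X n) (enc v)) = l2norm (\<lambda>k. Y n k - v k)" if "v \<in> l2" for n v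
    unfolding Y(1) diff_model by (rule norm_enc_l2[OF l2_diff(1)[OF model_l2[OF Y(2)] that]])
  obtain x where x: "x \<in> l2" "(\<lambda>n. l2norm (\<lambda>k. Y n k - x k)) \<longlonglongrightarrow> 0"
  proof (rule l2_complete)
    show "Y n \<in> l2" for n
      by (rule model_l2[OF Y(2)])
    show "\<exists>N. \<forall>m\<ge>N. \<forall>n\<ge>N. l2norm (\<lambda>k. Y m k - Y n k) < e" if "e > 0" for e
      using cauchy[OF that] by (simp only: norm[OF model_l2[OF Y(2)], folded Y(1)])
  qed blast
  have "x \<in> model"
    by (rule model_closed[OF Y(2) x])
  then show "\<exists>x\<in>hcarrier model_space. (\<lambda>n. hnorm model_space (hdiff model_space (X n) x)) \<longlonglongrightarrow> 0"
    using x(2) by (intro bexI[of _ "enc x"]) (auto simp: carrier_model norm[OF x(1)])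
qed

section \<open>Operators on the model space and their exponentials\<close>

text \<open>
Bounded operators on the model space, seen on sequences instead of their encodings.
\<close>

definition model_operator :: "((nat \<Rightarrow> complex) \<Rightarrow> nat \<Rightarrow> complex) \<Rightarrow> real \<Rightarrow> bool" where
  "model_operator f K \<longleftrightarrow>
    (\<forall>x\<in>model. f x \<in> model \<and> l2norm (f x) \<le> K * l2norm x) \<and>
    (\<forall>x\<in>model. \<forall>y\<in>model. f (\<lambda>n. x n + y n) = (\<lambda>n. f x n + f y n)) \<and>
    (\<forall>x\<in>model. \<forall>c. f (\<lambda>n. c * x n) = (\<lambda>n. c * f x n))"

lemma bounded_operatorI:
  assumes "model_operator f K" "\<And>x. x \<in> model \<Longrightarrow> F (enc x) = enc (f x)"
  shows "bounded_operator model_space F"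
  unfolding bounded_operator_def using assms
  by (auto simp: model_operator_def carrier_model add_model scale_model model_add model_scale
      norm_enc intro!: exI[of _ K])

lemma bounded_operatorE:
  assumes "bounded_operator model_space F"
  obtains f K where "model_operator f K" "\<forall>x\<in>model. F (enc x) = enc (f x)"
proof -
  define f where "f x = dec (F (enc x))" for x
  have closed: "\<exists>y\<in>model. F (enc x) = enc y" if "x \<in> model" for x
    using assms that by (auto simp: bounded_operator_def carrier_model)
  have F: "F (enc x) = enc (f x)" and fm: "f x \<in> model" if "x \<in> model" for x
    using closed[OF that] by (auto simp: f_def dec_enc)
  have "\<exists>K. \<forall>x\<in>model. hnorm model_space (F (enc x)) \<le> K * hnorm model_space (enc x)"
    using assms by (simp add: bounded_operator_def carrier_model)
  then obtain K where K: "\<And>x. x \<in> model \<Longrightarrow> hnorm model_space (F (enc x)) \<le> K * hnorm model_space (enc x)"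
    by blast
  have "model_operator f K"
    unfolding model_operator_def
  proof (intro conjI ballI allI)
    fix x :: "nat \<Rightarrow> complex" and c assume x: "x \<in> model"
    show "f x \<in> model" by (rule fm[OF x])
    show "l2norm (f x) \<le> K * l2norm x"
      using K[OF x] by (simp add: F[OF x] norm_enc fm x)
    have "F (hscale model_space c (enc x)) = hscale model_space c (F (enc x))"
      using assms x by (simp add: bounded_operator_def carrier_model)
    then show "f (\<lambda>n. c * x n) = (\<lambda>n. c * f x n)"
      using x by (simp add: scale_model F model_scale enc_eq_iff)
    fix y :: "nat \<Rightarrow> complex" assume y: "y \<in> model"
    have "F (hadd model_space (enc x) (enc y)) = hadd model_space (F (enc x)) (F (enc y))"
      using assms x y by (simp add: bounded_operator_def carrier_model)
    then show "f (\<lambda>n. x n + y n) = (\<lambda>n. f x n + f y n)"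
      using x y by (simp add: add_model F model_add enc_eq_iff)
  qed
  then show ?thesis using that F by blast
qed

lemma bounded_operator_hdiff:
  assumes "bounded_operator model_space F" "bounded_operator model_space G"
  shows "bounded_operator model_space (\<lambda>x. hdiff model_space (F x) (G x))"
proof -
  obtain f K where f: "model_operator f K" "\<forall>x\<in>model. F (enc x) = enc (f x)"
    by (rule bounded_operatorE[OF assms(1)])
  obtain g L where g: "model_operator g L" "\<forall>x\<in>model. G (enc x) = enc (g x)"
    by (rule bounded_operatorE[OF assms(2)])
  have "model_operator (\<lambda>x n. f x n - g x n) (K + L)"
    unfolding model_operator_def
  proof (intro conjI ballI allI)
    fix x :: "nat \<Rightarrow> complex" and c assume x: "x \<in> model"
    have fg: "f x \<in> model" "g x \<in> model" "l2norm (f x) \<le> K * l2norm x" "l2norm (g x) \<le> L * l2norm x"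
      using f(1) g(1) x by (simp_all add: model_operator_def)
    show "(\<lambda>n. f x n - g x n) \<in> model"
      by (rule model_diff[OF fg(1,2)])
    have "l2norm (\<lambda>n. f x n - g x n) \<le> l2norm (f x) + l2norm (g x)"
      by (intro l2_diff model_l2 fg)
    then show "l2norm (\<lambda>n. f x n - g x n) \<le> (K + L) * l2norm x"
      using fg(3,4) by (simp add: distrib_right)
    show "(\<lambda>n. f (\<lambda>n. c * x n) n - g (\<lambda>n. c * x n) n) = (\<lambda>n. c * (f x n - g x n))"
      using f(1) g(1) x by (simp add: model_operator_def right_diff_distrib)
    fix y :: "nat \<Rightarrow> complex" assume y: "y \<in> model"
    show "(\<lambda>n. f (\<lambda>n. x n + y n) n - g (\<lambda>n. x n + y n) n) = (\<lambda>n. f x n - g x n + (f y n - g y n))"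
      using f(1) g(1) x y by (simp add: model_operator_def algebra_simps)
  qed
  then show ?thesis
    by (rule bounded_operatorI) (simp add: f(2) g(2) diff_model)
qed

lemma operator_norm_le:
  assumes "0 \<le> M" "\<And>x. x \<in> model \<Longrightarrow> hnorm model_space (F (enc x)) \<le> M * l2norm x"
  shows "operator_norm model_space F \<le> M"
  unfolding operator_norm_def
proof (rule cSUP_least)
  show "{x \<in> hcarrier model_space. hnorm model_space x \<le> 1} \<noteq> {}"
    using model_zero l2_zero(2) by (auto simp: carrier_model norm_enc intro!: bexI[of _ "\<lambda>_. 0"])
  fix x assume "x \<in> {x \<in> hcarrier model_space. hnorm model_space x \<le> 1}"
  then obtain y where y: "x = enc y" "y \<in> model" "l2norm y \<le> 1"
    by (auto simp: carrier_model norm_enc)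
  show "hnorm model_space (F x) \<le> M"
    using assms(2)[OF y(2)] mult_left_le[OF y(3) assms(1)] by (simp add: y(1))
qed

lemma operator_norm_cong:
  assumes "\<And>x. x \<in> hcarrier H \<Longrightarrow> F x = G x"
  shows "operator_norm H F = operator_norm H G"
  unfolding operator_norm_def using assms by (intro SUP_cong) auto

text \<open>
The supremum in the operator norm is that of a set bounded above, so it bounds the operator
at unit vectors, and homogeneity does the rest.
\<close>

lemma operator_norm_bound:
  assumes F: "bounded_operator model_space F" and x: "x \<in> model"
  shows "hnorm model_space (F (enc x)) \<le> operator_norm model_space F * l2norm x"
proof -
  obtain f K where mf: "model_operator f K" and "\<forall>x\<in>model. F (enc x) = enc (f x)"
    by (rule bounded_operatorE[OF F])
  then have f: "F (enc x) = enc (f x)" "f x \<in> model" "f (\<lambda>n. c * x n) = (\<lambda>n. c * f x n)"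
    "l2norm (f x) \<le> K * l2norm x" if "x \<in> model" for x c
    using that by (simp_all add: model_operator_def)
  have norm: "hnorm model_space (F (enc x)) = l2norm (f x)" if "x \<in> model" for x
    by (simp add: f(1) f(2) norm_enc that)
  show ?thesis
  proof (cases "l2norm x = 0")
    case True
    then show ?thesis using f(4)[OF x] by (simp add: norm[OF x])
  next
    case False
    define N where "N = l2norm x"
    have N: "N > 0" using False l2norm_nonneg[OF model_l2[OF x]] by (simp add: N_def)
    define y where "y n = of_real (1 / N) * x n" for n
    have y: "y \<in> model" unfolding y_def by (rule model_scale[OF x])
    have "l2norm y = 1"
      unfolding y_def l2_scale(2)[OF model_l2[OF x]] using N by (simp add: N_def[symmetric] norm_divide)
    then have "hnorm model_space (F (enc y)) \<le> operator_norm model_space F"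
      unfolding operator_norm_def
    proof (intro cSUP_upper)
      show "bdd_above ((\<lambda>x. hnorm model_space (F x)) ` {x \<in> hcarrier model_space. hnorm model_space x \<le> 1})"
      proof (rule bdd_aboveI2)
        fix v assume "v \<in> {x \<in> hcarrier model_space. hnorm model_space x \<le> 1}"
        then obtain w where w: "v = enc w" "w \<in> model" "l2norm w \<le> 1"
          by (auto simp: carrier_model norm_enc)
        have "K * l2norm w \<le> \<bar>K\<bar> * 1"
          using w(3) l2norm_nonneg[OF model_l2[OF w(2)]] by (intro mult_mono) auto
        then show "hnorm model_space (F v) \<le> \<bar>K\<bar>"
          using f(4)[OF w(2)] by (simp add: w(1) norm[OF w(2)])
      qed
    qed (use y in \<open>auto simp: carrier_model norm_enc\<close>)
    moreover have "hnorm model_space (F (enc y)) = l2norm (f x) / N"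
      unfolding norm[OF y] unfolding y_def f(3)[OF x] l2_scale(2)[OF model_l2[OF f(2)[OF x]]]
      using N by (simp add: norm_divide)
    ultimately show ?thesis
      using N by (simp add: norm[OF x] N_def field_simps)
  qed
qed

text \<open>
The inequality between norms is tested at some vector that is not 0.
\<close>

lemma operator_norm_nonneg:
  assumes F: "bounded_operator model_space F"
  shows "0 \<le> operator_norm model_space F"
proof -
  obtain x where x: "x \<in> model" "0 < l2norm x"
    using approximate_kernel[of 1] by (metis zero_less_one)
  have "F (enc x) \<in> enc ` model"
    using F x(1) by (auto simp: bounded_operator_def carrier_model)
  then have "0 \<le> hnorm model_space (F (enc x))"
    by (auto simp: norm_enc intro!: l2norm_nonneg model_l2)
  also have "\<dots> \<le> operator_norm model_space F * l2norm x"
    by (rule operator_norm_bound[OF F x(1)])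
  finally show ?thesis
    using x(2) by (simp add: zero_le_mult_iff)
qed

lemma bounded_operator_symbol_op:
  assumes f: "bounded_symbol f M"
  shows "bounded_operator model_space (symbol_op f)"
proof (rule bounded_operatorI)
  show "model_operator (backshift f) M"
    unfolding model_operator_def
    using model_backshift[OF f] backshift_bound(2)[OF f model_l2] backshift_linear(1)[OF f model_l2 model_l2]
      backshift_linear(2)[OF f model_l2 l2_zero(1)] by simp
qed (rule symbol_op_enc)

lemma operator_norm_symbol_op:
  assumes f: "bounded_symbol f M"
  shows "operator_norm model_space (symbol_op f) \<le> M"
  by (rule operator_norm_le[OF bounded_symbol_nonneg[OF f]])
     (simp add: symbol_op_enc norm_enc model_backshift[OF f] backshift_bound(2)[OF f] model_l2)

lemma symbol_op_mult:
  assumes "bounded_symbol f M" "bounded_symbol g N" "x \<in> hcarrier model_space"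
  shows "symbol_op f (symbol_op g x) = symbol_op (\<lambda>z. f z * g z) x"
  using assms by (auto simp: carrier_model symbol_op_enc backshift_mult[OF assms(1,2)] model_l2)

lemma symbol_op_diff:
  assumes "bounded_symbol f M" "bounded_symbol g N" "x \<in> hcarrier model_space"
  shows "hdiff model_space (symbol_op f x) (symbol_op g x) = symbol_op (\<lambda>z. f z - g z) x"
  using assms
  by (auto simp: carrier_model symbol_op_enc diff_model backshift_diff_symbol[OF assms(1,2)] model_l2 enc_def intro!: ext)

lemma symbol_op_add:
  assumes "bounded_symbol f M" "bounded_symbol g N" "x \<in> hcarrier model_space"
  shows "hadd model_space (symbol_op f x) (symbol_op g x) = symbol_op (\<lambda>z. f z + g z) x"
  using assms
  by (auto simp: carrier_model symbol_op_enc add_model backshift_add_symbol[OF assms(1,2)] model_l2 enc_def intro!: ext)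

lemma symbol_op_scale:
  assumes "bounded_symbol f M" "x \<in> hcarrier model_space"
  shows "hscale model_space c (symbol_op f x) = symbol_op (\<lambda>z. c * f z) x"
  using assms
  by (auto simp: carrier_model symbol_op_enc scale_model backshift_cmult_symbol[OF assms(1)] model_l2 enc_def intro!: ext)

lemma symbol_op_const:
  assumes "x \<in> hcarrier model_space"
  shows "symbol_op (\<lambda>z. c) x = hscale model_space c x"
  using assms by (auto simp: carrier_model symbol_op_enc scale_model backshift_const enc_def intro!: ext)

lemma symbol_op_closed:
  assumes "bounded_symbol f M" "x \<in> hcarrier model_space"
  shows "symbol_op f x \<in> hcarrier model_space"
  using assms by (auto simp: carrier_model symbol_op_enc model_backshift[OF assms(1)])

lemma symbol_op_cong:
  assumes "\<And>z. z \<in> ball 0 1 \<Longrightarrow> f z = g z"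
  shows "symbol_op f = symbol_op g"
  using backshift_cong[OF assms] by (simp add: symbol_op_def[abs_def])

lemma bounded_symbol_power:
  assumes "bounded_symbol f M"
  shows "bounded_symbol (\<lambda>z. f z ^ n) (M ^ n)"
proof (induction n)
  case 0
  then show ?case by (simp add: bounded_symbol_def)
next
  case (Suc n)
  then show ?case using bounded_symbol_mult[OF assms Suc] by simp
qed

lemma symbol_op_funpow:
  assumes f: "bounded_symbol f M"
    and A: "\<And>x. x \<in> hcarrier model_space \<Longrightarrow> A x = symbol_op f x"
    and x: "x \<in> hcarrier model_space"
  shows "(A ^^ n) x = symbol_op (\<lambda>z. f z ^ n) x"
proof (induction n)
  case 0
  have "hscale model_space 1 x = x"
    using x by (auto simp: carrier_model scale_model)
  then show ?case using symbol_op_const[OF x, of 1] by simp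
next
  case (Suc n)
  then show ?case
    by (simp add: A symbol_op_closed[OF bounded_symbol_power[OF f] x]
        symbol_op_mult[OF f bounded_symbol_power[OF f] x])
qed

lemma bounded_symbol_exp_sum:
  assumes f: "bounded_symbol f M"
  shows "bounded_symbol (\<lambda>z. \<Sum>k<n. f z ^ k / fact k) (\<Sum>k<n. M ^ k / fact k)"
proof (induction n)
  case 0
  then show ?case by (simp add: bounded_symbol_def)
next
  case (Suc n)
  have "bounded_symbol (\<lambda>z. 1 / fact n * f z ^ n) (cmod (1 / fact n) * M ^ n)"
    by (rule bounded_symbol_mult[OF bounded_symbol_const bounded_symbol_power[OF f]])
  then show ?case
    using bounded_symbol_add[OF Suc] by (simp add: norm_divide)
qed

lemma exp_partial_sum_symbol_op:
  assumes f: "bounded_symbol f M"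
    and A: "\<And>x. x \<in> hcarrier model_space \<Longrightarrow> A x = symbol_op f x"
    and x: "x \<in> hcarrier model_space"
  shows "exp_partial_sum model_space A n x = symbol_op (\<lambda>z. \<Sum>k<n. f z ^ k / fact k) x"
proof (induction n)
  case 0
  have "hscale model_space 0 x = hzero model_space"
    using x by (auto simp: carrier_model scale_model zero_model)
  then show ?case using symbol_op_const[OF x, of 0] by simp
next
  case (Suc n)
  have b: "bounded_symbol (\<lambda>z. 1 / fact n * f z ^ n) (cmod (1 / fact n) * M ^ n)"
    by (rule bounded_symbol_mult[OF bounded_symbol_const bounded_symbol_power[OF f]])
  show ?case
    by (simp only: exp_partial_sum.simps Suc symbol_op_funpow[OF f A x]
        symbol_op_scale[OF bounded_symbol_power[OF f] x]
        symbol_op_add[OF bounded_symbol_exp_sum[OF f] b x]) simp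
qed

text \<open>
On a bounded set of values the exponential series converges uniformly. Through the functional
calculus this becomes convergence in operator norm.
\<close>

lemma exp_symbol_tail:
  assumes f: "bounded_symbol f M"
  shows "bounded_symbol (\<lambda>z. (\<Sum>k<Suc n. f z ^ k / fact k) - exp (f z)) (exp M * M ^ Suc n / fact n)"
proof -
  have M: "0 \<le> M" by (rule bounded_symbol_nonneg[OF f])
  have "cmod ((\<Sum>k<Suc n. w ^ k / fact k) - exp w) \<le> exp M * M ^ Suc n / fact n" if "cmod w \<le> M" for w
  proof -
    have "cmod ((\<Sum>k<Suc n. w ^ k / fact k) - exp w) \<le> exp \<bar>Re w\<bar> * cmod w ^ Suc n / fact n"
      using Taylor_exp[of w n] by (simp only: lessThan_Suc_atMost norm_minus_commute)
    also have "\<dots> \<le> exp M * M ^ Suc n / fact n"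
      using that abs_Re_le_cmod[of w] M by (intro divide_right_mono mult_mono power_mono) auto
    finally show ?thesis .
  qed
  then show ?thesis
    using f by (auto simp: bounded_symbol_def simp del: sum.lessThan_Suc intro!: holomorphic_intros)
qed

lemma bounded_symbol_exp:
  assumes f: "bounded_symbol f M"
  shows "bounded_symbol (\<lambda>z. exp (f z)) (exp M)"
  using f complex_Re_le_cmod order_trans
  by (fastforce simp: bounded_symbol_def intro!: holomorphic_intros)

text \<open>
The operator exponential is specified only as some norm limit of the exponential series. The
operator with symbol \<open>exp f\<close> is such a limit, and two norm limits of the same sequence agree on
the carrier.
\<close>

theorem operator_exp_symbol_op:
  assumes f: "bounded_symbol f M"
    and A: "\<And>x. x \<in> hcarrier model_space \<Longrightarrow> A x = symbol_op f x"
    and x: "x \<in> hcarrier model_space"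
  shows "operator_exp model_space A x = symbol_op (\<lambda>z. exp (f z)) x"
proof -
  let ?S = "exp_partial_sum model_space A"
  let ?E = "symbol_op (\<lambda>z. exp (f z))"
  let ?p = "\<lambda>n z. \<Sum>k<n. f z ^ k / fact k"
  let ?D = "\<lambda>E n. operator_norm model_space (\<lambda>x. hdiff model_space (?S n x) (E x))"
  let ?good = "\<lambda>E. bounded_operator model_space E \<and> ?D E \<longlonglongrightarrow> 0"
  note fe = bounded_symbol_exp[OF f]
  have S: "?S n x = symbol_op (?p n) x" if "x \<in> hcarrier model_space" for n x
    by (rule exp_partial_sum_symbol_op[OF f A that])
  have D: "?D E n = operator_norm model_space (\<lambda>x. hdiff model_space (symbol_op (?p n) x) (E x))" for E n
    by (rule operator_norm_cong) (simp add: S)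
  have D_bounded: "bounded_operator model_space (\<lambda>x. hdiff model_space (symbol_op (?p n) x) (E x))"
    if "bounded_operator model_space E" for E n
    by (intro bounded_operator_hdiff bounded_operator_symbol_op[OF bounded_symbol_exp_sum[OF f]] that)
  have D_nonneg: "0 \<le> ?D E n" if "bounded_operator model_space E" for E n
    unfolding D by (rule operator_norm_nonneg[OF D_bounded[OF that]])
  have good: "?good ?E"
  proof
    show "bounded_operator model_space ?E"
      by (rule bounded_operator_symbol_op[OF fe])
    have le: "?D ?E (Suc n) \<le> exp M * M ^ Suc n / fact n" for n
    proof -
      have "?D ?E (Suc n) = operator_norm model_space (symbol_op (\<lambda>z. ?p (Suc n) z - exp (f z)))"
        by (rule operator_norm_cong)
           (simp only: S symbol_op_diff[OF bounded_symbol_exp_sum[OF f] fe])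
      also have "\<dots> \<le> exp M * M ^ Suc n / fact n"
        by (rule operator_norm_symbol_op[OF exp_symbol_tail[OF f]])
      finally show ?thesis .
    qed
    have "(\<lambda>n. exp M * M * (inverse (fact n) * M ^ n)) \<longlonglongrightarrow> exp M * M * 0"
      by (intro tendsto_intros summable_LIMSEQ_zero summable_exp)
    then have lim: "(\<lambda>n. exp M * M ^ Suc n / fact n) \<longlonglongrightarrow> 0"
      by (simp add: field_simps)
    have "(\<lambda>n. ?D ?E (Suc n)) \<longlonglongrightarrow> 0"
      by (rule tendsto_sandwich[OF _ _ tendsto_const lim])
         (intro always_eventually allI le D_nonneg bounded_operator_symbol_op[OF fe])+
    then show "?D ?E \<longlonglongrightarrow> 0"
      by (rule LIMSEQ_imp_Suc)
  qed
  define E' where "E' = operator_exp model_space A"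
  have good': "?good E'"
    unfolding E'_def operator_exp_def by (rule someI[of ?good, OF good])
  obtain y where y: "x = enc y" "y \<in> model"
    using x by (auto simp: carrier_model)
  obtain e' where e': "E' x = enc e'" "e' \<in> model"
    using good' x by (auto simp: bounded_operator_def carrier_model)
  define e where "e = backshift (\<lambda>z. exp (f z)) y"
  have e: "?E x = enc e" "e \<in> model"
    by (simp_all add: e_def y symbol_op_enc model_backshift[OF fe])
  have close: "l2norm (\<lambda>k. backshift (?p n) y k - v k) \<le> ?D E n * l2norm y"
    if E: "bounded_operator model_space E" and v: "E x = enc v" "v \<in> model" for E v n
  proof -
    note p = bounded_symbol_exp_sum[OF f]
    show ?thesis
      unfolding D using operator_norm_bound[OF D_bounded[OF E] y(2), of n] v
      by (simp add: y(1)[symmetric]) (simp add: y symbol_op_enc diff_model norm_enc model_diff model_backshift[OF p])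
  qed
  have "l2norm (\<lambda>k. e' k - e k) \<le> (?D E' n + ?D ?E n) * l2norm y" for n
  proof -
    note p = bounded_symbol_exp_sum[OF f]
    let ?q = "backshift (?p n) y"
    have q: "?q \<in> model" by (rule model_backshift[OF p y(2)])
    have "l2norm (\<lambda>k. (?q k - e k) - (?q k - e' k)) \<le> l2norm (\<lambda>k. ?q k - e k) + l2norm (\<lambda>k. ?q k - e' k)"
      by (intro l2_diff model_l2 q e e')
    also have "\<dots> \<le> ?D ?E n * l2norm y + ?D E' n * l2norm y"
      using good good' by (intro add_mono close e e') auto
    finally show ?thesis by (simp add: algebra_simps)
  qed
  moreover have "(\<lambda>n. (?D E' n + ?D ?E n) * l2norm y) \<longlonglongrightarrow> (0 + 0) * l2norm y"
    using good good' by (intro tendsto_intros) auto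
  ultimately have "l2norm (\<lambda>k. e' k - e k) \<le> 0"
    by (intro LIMSEQ_le_const) auto
  moreover have d: "(\<lambda>k. e' k - e k) \<in> l2"
    by (intro l2_diff model_l2 e e')
  ultimately have "(\<lambda>k. e' k - e k) = (\<lambda>_. 0)"
    using l2norm_nonneg[OF d] by (intro l2norm_eq_0) auto
  then have "e' = e"
    by (simp add: fun_eq_iff)
  then show ?thesis
    using e e' by (simp add: E'_def)
qed

section \<open>Spectra and decay rates\<close>

text \<open>
For \<open>w \<noteq> w\<^sub>0\<close> the inverse of \<open>w - f\<close> modulo \<open>\<theta>\<close> yields a two-sided inverse operator, because \<open>\<theta>(L)\<close>
vanishes on the model space. At \<open>w\<^sub>0\<close> the operator is \<open>\<phi>(L)\<close>, and a bounded inverse would contradict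
the approximate eigenvectors.
\<close>

lemma symbol_op_spectrum:
  assumes f: "bounded_symbol f M" and eq: "\<And>z. f z = w\<^sub>0 - \<phi> z"
  shows "operator_spectrum model_space (symbol_op f) = {w\<^sub>0}"
proof (rule set_eqI)
  fix w :: complex
  have b: "bounded_symbol (\<lambda>z. w - f z) (cmod w + cmod (-1) * M)"
    using bounded_symbol_add[OF bounded_symbol_const[of w] bounded_symbol_mult[OF bounded_symbol_const[of "-1"] f]]
    by simp
  have res: "hdiff model_space (hscale model_space w x) (symbol_op f x) = symbol_op (\<lambda>z. w - f z) x"
    if "x \<in> hcarrier model_space" for x
    using symbol_op_diff[OF bounded_symbol_const[of w] f that] symbol_op_const[OF that, of w] by simp
  show "w \<in> operator_spectrum model_space (symbol_op f) \<longleftrightarrow> w \<in> {w\<^sub>0}"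
  proof (cases "w = w\<^sub>0")
    case True
    have "\<not> (bounded_operator model_space B \<and> (\<forall>x\<in>hcarrier model_space.
        B (hdiff model_space (hscale model_space w x) (symbol_op f x)) = x))" for B
    proof
      assume B: "bounded_operator model_space B \<and> (\<forall>x\<in>hcarrier model_space.
        B (hdiff model_space (hscale model_space w x) (symbol_op f x)) = x)"
      then have "\<exists>K. \<forall>x\<in>model. hnorm model_space (B (enc x)) \<le> K * l2norm x"
        by (simp add: bounded_operator_def carrier_model norm_enc)
      then obtain K where K: "\<And>x. x \<in> model \<Longrightarrow> hnorm model_space (B (enc x)) \<le> K * l2norm x"
        by blast
      \<comment> \<open>small enough that an inverse bounded by \<open>K\<close> would halve the norm of \<open>x\<close>\<close>
      define \<delta> where "\<delta> = 1 / (2 * (\<bar>K\<bar> + 1))"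
      have "\<delta> > 0" by (simp add: \<delta>_def)
      then obtain x where x: "x \<in> model" "0 < l2norm x" "l2norm (backshift \<phi> x) \<le> \<delta> * l2norm x"
        by (rule approximate_kernel)
      have "B (symbol_op \<phi> (enc x)) = enc x"
        using bspec[OF conjunct2[OF B], of "enc x"] x(1) res[of "enc x"] by (simp add: carrier_model True eq)
      then have "l2norm x \<le> K * l2norm (backshift \<phi> x)"
        using K[OF model_backshift[OF \<phi>_symbol x(1)]] x(1) by (simp add: symbol_op_enc norm_enc)
      also have "\<dots> \<le> (\<bar>K\<bar> + 1) * l2norm (backshift \<phi> x)"
        using l2norm_nonneg[OF model_l2[OF model_backshift[OF \<phi>_symbol x(1)]]] by (intro mult_right_mono) auto
      also have "\<dots> \<le> (\<bar>K\<bar> + 1) * (\<delta> * l2norm x)"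
        by (intro mult_left_mono x) auto
      also have "\<dots> = l2norm x / 2"
        by (simp add: \<delta>_def field_simps)
      finally show False using x(2) by simp
    qed
    then show ?thesis
      using True by (auto simp: operator_spectrum_def)
  next
    case False
    then obtain u N c where u: "bounded_symbol u N"
      and uc: "\<And>z. z \<in> ball 0 1 \<Longrightarrow> u z * ((w\<^sub>0 - w) - \<phi> z) = 1 - c * \<theta> z"
      using resolvent_symbol[of "w\<^sub>0 - w"] by (metis eq_iff_diff_eq_0)
    define v where "v z = - 1 * u z" for z
    have v: "bounded_symbol v (cmod (-1) * N)"
      unfolding v_def by (rule bounded_symbol_mult[OF bounded_symbol_const u])
    have c\<theta>: "bounded_symbol (\<lambda>z. c * \<theta> z) (cmod c * 1)"
      by (rule bounded_symbol_mult[OF bounded_symbol_const \<theta>_symbol])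
    have one: "symbol_op (\<lambda>z. 1 - c * \<theta> z) x = x" if "x \<in> hcarrier model_space" for x
      using that
      by (auto simp: carrier_model symbol_op_enc enc_def model_def backshift_const
          backshift_diff_symbol[OF bounded_symbol_const c\<theta>] backshift_cmult_symbol[OF \<theta>_symbol] intro!: ext)
    have "v z * (w - f z) = 1 - c * \<theta> z" if "z \<in> ball 0 1" for z
      using uc[OF that] by (simp add: v_def eq algebra_simps)
    then have vf: "symbol_op (\<lambda>z. v z * (w - f z)) = symbol_op (\<lambda>z. 1 - c * \<theta> z)"
      by (rule symbol_op_cong)
    have "symbol_op v (hdiff model_space (hscale model_space w x) (symbol_op f x)) = x \<and>
        hdiff model_space (hscale model_space w (symbol_op v x)) (symbol_op f (symbol_op v x)) = x"
      if x: "x \<in> hcarrier model_space" for x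
      using symbol_op_mult[OF v b x] symbol_op_mult[OF b v x] one[OF x] vf
      by (simp add: res x symbol_op_closed[OF v x] mult.commute)
    then show ?thesis
      using False bounded_operator_symbol_op[OF v] by (auto simp: operator_spectrum_def)
  qed
qed

lemma Limsup_le_of_eventually:
  assumes "\<And>C. L < C \<Longrightarrow> \<forall>\<^sub>F x in F. f x \<le> C"
  shows "Limsup F (\<lambda>x. ereal (f x)) \<le> ereal L"
proof (rule ereal_le_epsilon2)
  fix e :: real assume "0 < e"
  then have "\<forall>\<^sub>F x in F. f x \<le> L + e"
    by (intro assms) simp
  then have "Limsup F (\<lambda>x. ereal (f x)) \<le> ereal (L + e)"
    by (intro Limsup_bounded) (auto elim: eventually_mono)
  then show "Limsup F (\<lambda>x. ereal (f x)) \<le> ereal L + ereal e"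
    by simp
qed

lemma model_nonzero_image:
  obtains x where "x \<in> model" "backshift \<phi> x \<noteq> (\<lambda>_. 0)"
proof -
  obtain x where x: "x \<in> model" "0 < l2norm x"
    using approximate_kernel[of 1] by (metis zero_less_one)
  have "backshift \<phi> x \<noteq> (\<lambda>_. 0)"
    using backshift_\<phi>_injective[OF model_l2[OF x(1)]] x(2) l2_zero(2) by auto
  with x(1) show ?thesis by (rule that)
qed

lemma neg_\<phi>_symbol: "bounded_symbol (\<lambda>z. - \<phi> z) 1"
  using \<phi>_symbol by (auto simp: bounded_symbol_def intro!: holomorphic_intros)

lemma one_minus_\<phi>_symbol: "bounded_symbol (\<lambda>z. 1 - \<phi> z) 1"
  unfolding bounded_symbol_def
proof (intro conjI ballI)
  show "(\<lambda>z. 1 - \<phi> z) holomorphic_on ball 0 1"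
    using \<phi>_symbol by (auto simp: bounded_symbol_def intro!: holomorphic_intros)
  show "cmod (1 - \<phi> z) \<le> 1" if "z \<in> ball 0 1" for z
    using \<phi>_contraction[OF that] norm_ge_zero[of "\<phi> z"] by linarith
qed

lemma neg_\<phi>_op_nonzero: "\<exists>x\<in>hcarrier model_space. symbol_op (\<lambda>z. - \<phi> z) x \<noteq> hzero model_space"
proof -
  obtain x where x: "x \<in> model" "backshift \<phi> x \<noteq> (\<lambda>_. 0)"
    by (rule model_nonzero_image)
  have "backshift (\<lambda>z. - \<phi> z) x = (\<lambda>n. - backshift \<phi> x n)"
    using backshift_cmult_symbol[OF \<phi>_symbol model_l2[OF x(1)], of "-1"] by auto
  with x(2) have "backshift (\<lambda>z. - \<phi> z) x \<noteq> (\<lambda>_. 0)"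
    by (auto simp: fun_eq_iff)
  with x(1) show ?thesis
    by (auto simp: carrier_model symbol_op_enc zero_model enc_eq_iff)
qed

lemma one_minus_\<phi>_op_nontrivial: "\<exists>x\<in>hcarrier model_space. symbol_op (\<lambda>z. 1 - \<phi> z) x \<noteq> x"
proof -
  obtain x where x: "x \<in> model" "backshift \<phi> x \<noteq> (\<lambda>_. 0)"
    by (rule model_nonzero_image)
  have "backshift (\<lambda>z. 1 - \<phi> z) x = (\<lambda>n. x n - backshift \<phi> x n)"
    using backshift_diff_symbol[OF bounded_symbol_const[of 1] \<phi>_symbol model_l2[OF x(1)]]
    by (auto simp: backshift_const)
  with x(2) have "backshift (\<lambda>z. 1 - \<phi> z) x \<noteq> x"
    by (auto simp: fun_eq_iff)
  with x(1) show ?thesis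
    by (auto simp: carrier_model symbol_op_enc enc_eq_iff)
qed

lemma semigroup_decay:
  assumes C: "1 / exp 1 < C"
  shows "\<forall>\<^sub>F t in at_top. t * operator_norm model_space (\<lambda>x. symbol_op (\<lambda>z. - \<phi> z)
    (operator_exp model_space (\<lambda>y. hscale model_space (complex_of_real t) (symbol_op (\<lambda>z. - \<phi> z) y)) x)) \<le> C"
  using \<phi>_decay[OF C] eventually_gt_at_top[of 0]
proof eventually_elim
  case (elim t)
  have t\<phi>: "bounded_symbol (\<lambda>z. complex_of_real t * - \<phi> z) (cmod (of_real t) * 1)"
    by (rule bounded_symbol_mult[OF bounded_symbol_const neg_\<phi>_symbol])
  let ?h = "\<lambda>z. - \<phi> z * exp (complex_of_real t * - \<phi> z)"
  have h: "bounded_symbol ?h (C / t)"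
    unfolding bounded_symbol_def
  proof (intro conjI ballI)
    show "?h holomorphic_on ball 0 1"
      using \<phi>_symbol by (auto simp: bounded_symbol_def intro!: holomorphic_intros)
    fix z :: complex assume z: "z \<in> ball 0 1"
    have "cmod (?h z) = cmod (\<phi> z) * cmod (exp (of_real (- t) * \<phi> z))"
      by (simp add: norm_mult del: norm_exp_eq_Re)
    also have "\<dots> \<le> cmod (\<phi> z) * exp (- (t * (1 - cmod (1 - \<phi> z))))"
      using elim by (intro mult_left_mono exp_symbol_decay) auto
    also have "\<dots> \<le> C / t"
      using elim(1)[rule_format, OF z] elim(2) by (simp add: field_simps)
    finally show "cmod (?h z) \<le> C / t" .
  qed
  have "operator_norm model_space (\<lambda>x. symbol_op (\<lambda>z. - \<phi> z)
      (operator_exp model_space (\<lambda>y. hscale model_space (complex_of_real t) (symbol_op (\<lambda>z. - \<phi> z) y)) x))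
    = operator_norm model_space (symbol_op ?h)"
  proof (rule operator_norm_cong)
    fix x assume x: "x \<in> hcarrier model_space"
    have "operator_exp model_space (\<lambda>y. hscale model_space (complex_of_real t) (symbol_op (\<lambda>z. - \<phi> z) y)) x
        = symbol_op (\<lambda>z. exp (complex_of_real t * - \<phi> z)) x"
      by (rule operator_exp_symbol_op[OF t\<phi> symbol_op_scale[OF neg_\<phi>_symbol] x])
    then show "symbol_op (\<lambda>z. - \<phi> z)
        (operator_exp model_space (\<lambda>y. hscale model_space (complex_of_real t) (symbol_op (\<lambda>z. - \<phi> z) y)) x)
      = symbol_op ?h x"
      by (simp only: symbol_op_mult[OF neg_\<phi>_symbol bounded_symbol_exp[OF t\<phi>] x])
  qed
  also have "\<dots> \<le> C / t"
    by (rule operator_norm_symbol_op[OF h])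
  finally show ?case
    using elim(2) by (simp add: field_simps)
qed

lemma power_decay:
  assumes C: "1 / exp 1 < C"
  shows "\<forall>\<^sub>F n in sequentially. real n * operator_norm model_space (\<lambda>x. hdiff model_space
    ((symbol_op (\<lambda>z. 1 - \<phi> z) ^^ (n + 1)) x) ((symbol_op (\<lambda>z. 1 - \<phi> z) ^^ n) x)) \<le> C"
  using eventually_compose_filterlim[OF \<phi>_decay[OF C] filterlim_real_sequentially] eventually_gt_at_top[of 0]
proof eventually_elim
  case (elim n)
  note T = one_minus_\<phi>_symbol
  let ?h = "\<lambda>z. (1 - \<phi> z) ^ (n + 1) - (1 - \<phi> z) ^ n"
  have h: "bounded_symbol ?h (C / real n)"
    unfolding bounded_symbol_def
  proof (intro conjI ballI)
    show "?h holomorphic_on ball 0 1"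
      using T by (auto simp: bounded_symbol_def intro!: holomorphic_intros)
    fix z :: complex assume z: "z \<in> ball 0 1"
    have "?h z = - (\<phi> z * (1 - \<phi> z) ^ n)"
      by (simp add: algebra_simps)
    then have "cmod (?h z) = cmod (\<phi> z) * cmod ((1 - \<phi> z) ^ n)"
      by (simp only: norm_mult norm_minus_cancel)
    also have "\<dots> \<le> cmod (\<phi> z) * exp (- (real n * (1 - cmod (1 - \<phi> z))))"
      by (intro mult_left_mono power_symbol_decay) auto
    also have "\<dots> \<le> C / real n"
      using elim(1)[rule_format, OF z] elim(2) by (simp add: field_simps)
    finally show "cmod (?h z) \<le> C / real n" .
  qed
  have "operator_norm model_space (\<lambda>x. hdiff model_space
      ((symbol_op (\<lambda>z. 1 - \<phi> z) ^^ (n + 1)) x) ((symbol_op (\<lambda>z. 1 - \<phi> z) ^^ n) x))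
    = operator_norm model_space (symbol_op ?h)"
    by (rule operator_norm_cong)
       (simp only: symbol_op_funpow[OF T refl] symbol_op_diff[OF bounded_symbol_power[OF T] bounded_symbol_power[OF T]])
  also have "\<dots> \<le> C / real n"
    by (rule operator_norm_symbol_op[OF h])
  finally show ?case
    using elim(2) by (simp add: field_simps)
qed

theorem theorem2p3:
  "(\<exists>(H :: (real \<Rightarrow> complex) inner_space) A.
      complex_hilbert_space H \<and> bounded_operator H A \<and>
      (\<exists>x\<in>hcarrier H. A x \<noteq> hzero H) \<and>
      operator_spectrum H A = {0} \<and>
      Limsup at_top (\<lambda>t :: real. ereal
        (t * operator_norm H (\<lambda>x. A (operator_exp H (\<lambda>y. hscale H (complex_of_real t) (A y)) x))))
        \<le> ereal (1 / exp 1)) \<and>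
   (\<exists>(H :: (real \<Rightarrow> complex) inner_space) T.
      complex_hilbert_space H \<and> bounded_operator H T \<and>
      (\<exists>x\<in>hcarrier H. T x \<noteq> x) \<and>
      operator_spectrum H T = {1} \<and>
      limsup (\<lambda>n :: nat. ereal
        (real n * operator_norm H (\<lambda>x. hdiff H ((T ^^ (n + 1)) x) ((T ^^ n) x))))
        \<le> ereal (1 / exp 1))"
proof
  show "\<exists>(H :: (real \<Rightarrow> complex) inner_space) A.
      complex_hilbert_space H \<and> bounded_operator H A \<and>
      (\<exists>x\<in>hcarrier H. A x \<noteq> hzero H) \<and>
      operator_spectrum H A = {0} \<and>
      Limsup at_top (\<lambda>t :: real. ereal
        (t * operator_norm H (\<lambda>x. A (operator_exp H (\<lambda>y. hscale H (complex_of_real t) (A y)) x))))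
        \<le> ereal (1 / exp 1)"
    by (intro exI[of _ model_space] exI[of _ "symbol_op (\<lambda>z. - \<phi> z)"] conjI hilbert_model
        bounded_operator_symbol_op[OF neg_\<phi>_symbol] neg_\<phi>_op_nonzero
        symbol_op_spectrum[OF neg_\<phi>_symbol] Limsup_le_of_eventually semigroup_decay) auto
  show "\<exists>(H :: (real \<Rightarrow> complex) inner_space) T.
      complex_hilbert_space H \<and> bounded_operator H T \<and>
      (\<exists>x\<in>hcarrier H. T x \<noteq> x) \<and>
      operator_spectrum H T = {1} \<and>
      limsup (\<lambda>n :: nat. ereal
        (real n * operator_norm H (\<lambda>x. hdiff H ((T ^^ (n + 1)) x) ((T ^^ n) x))))
        \<le> ereal (1 / exp 1)"
    by (intro exI[of _ model_space] exI[of _ "symbol_op (\<lambda>z. 1 - \<phi> z)"] conjI hilbert_model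
        bounded_operator_symbol_op[OF one_minus_\<phi>_symbol] one_minus_\<phi>_op_nontrivial
        symbol_op_spectrum[OF one_minus_\<phi>_symbol] Limsup_le_of_eventually power_decay) auto
qed

end
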